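(* Let $G$ be a Hodge group with complex Lie algebra $\mathfrak{g}_{\mathbb C}=\mathfrak{sl}_2\mathbb{C}$. Assume that $(V,\varphi)$ is a Hodge representation of $G$ with the property that $V_{\mathbb C}=\mathrm{Sym}^p\mathbb{C}^2$ for some integer $p\ge 1$, and satisfying the normalization $\sigma_1(\mathtt{T}_\varphi)\ge 0$, where $\mathtt{T}_\varphi$ is the associated grading element. Then $(V,\varphi)$ is principal if and only if $\mathtt{T}_\varphi=\mathtt{T}^1$.
   Context: Hodge representations. Let $V$ be a (finite-dimensional) rational vector space, $w\in\mathbb{Z}$, and $Q:V\times V\to\mathbb{Q}$ a nondegenerate bilinear form with $Q(u,v)=(-1)^wQ(v,u)$. A $Q$-polarized Hodge structure of weight $w$ on $V$ is a nonconstant homomorphism $\phi:S^1\to\mathrm{Aut}(V_{\mathbb R},Q)$ of $\mathbb{R}$-algebraic groups with $\phi(-1)=(-1)^w\mathrm{Id}$ and $Q(v,\phi(\mathbf{i})\overline v)>0$ for all $0\ne v\in V_{\mathbb C}$. Its Hodge decomposition is $V_{\mathbb C}=\bigoplus_{p+q=w}V^{p,q}$, $V^{p,q}=\{v\in V_{\mathbb C}\mid \phi(z)v=z^{p-q}v\ \forall z\in S^1\}$. Let $G$ be a $\mathbb{Q}$-algebraic group, $\pi:G\to\mathrm{Aut}(V,Q)$ a homomorphism of $\mathbb{Q}$-algebraic groups such that $\pi_*:\mathfrak{g}_{\mathbb C}\to\mathrm{End}(V_{\mathbb C},Q)$ is injective, and $\varphi:S^1\to G_{\mathbb R}$ a nonconstant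 homomorphism of $\mathbb{R}$-algebraic groups. Then $(V,Q,\pi,\varphi)$, abbreviated $(V,\varphi)$, is a Hodge representation of $G$ if $\pi\circ\varphi$ is a $Q$-polarized Hodge structure on $V$. A $\mathbb{Q}$-algebraic group admitting a Hodge representation is a Hodge group. Grading element. Given $(V,\varphi)$, the grading element $\mathtt{T}_\varphi\in\mathbf{i}\,\mathfrak{g}_{\mathbb R}$ is the semisimple element (tangent, up to scaling, to $\varphi(S^1)$) that acts on $V^{p,q}$ with eigenvalue $(p-q)/2$. Let $V_\ell\subset V_{\mathbb C}$ be the $\ell$-eigenspace of $\mathtt{T}_\varphi$. Fix a compact maximal torus $T\subset G_{\mathbb R}$ with $\varphi(S^1)\subset T$; let $\mathfrak{t}_{\mathbb C}\subset\mathfrak{g}_{\mathbb C}$ be the corresponding Cartan subalgebra, so $\mathtt{T}_\varphi\in\mathfrak{t}_{\mathbb C}$. One chooses a Borel subalgebra containing $\mathfrak{t}_{\mathbb C}$ and contained in the sum of the eigenspaces of $\mathrm{ad}\,\mathtt{T}_\varphi$ with nonnegative eigenvalue; let $\sigma_1$ be the corresponding simple root and $\mathtt{T}^1\in\mathfrak{t}_{\mathbb C}$ the element with $\sigma_1(\mathtt{T}^1)=1$. Then $\mathtt{T}_\varphi=n_1\mathtt{T}^1$ with $n_1=\sigma_1(\mathtt{T}_\varphi)\in\mathbb{Z}_{\ge 0}$ (this nonnegativity is the normalization). Principal. Let $m$ be the largest $\mathtt{T}_\varphi$-eigenvalue on $V_{\mathbb C}$, so $V_{\mathbb C}=V_m\oplus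 V_{m-1}\oplus\cdots\oplus V_{1-m}\oplus V_{-m}$. The Hodge representation is principal if its Hodge numbers are $(1,1,\dots,1)$, i.e. $\dim_{\mathbb C}V_\ell=1$ for $\ell=m,m-1,\dots,-m$. *)

theory Defs
  imports "HOL-Analysis.Analysis" "HOL-Computational_Algebra.Polynomial"
begin

text \<open>
  A rational vector space is taken in coordinates as \<^typ>\<open>rat^'v\<close>, so that its
  complexification is \<^typ>\<open>complex^'v\<close> and the real structure is given by real entries.
  A linear algebraic group over a subfield \<open>K\<close> of the complex numbers is identified with its group
  of complex points inside \<open>GL\<^sub>n\<close>, cut out by polynomials with coefficients in \<open>K\<close>; this loses
  nothing, since algebraic groups in characteristic zero are reduced.
\<close>

subsection \<open>Complex matrices as a complex Lie algebra\<close>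

definition cscale :: "complex \<Rightarrow> complex^'n^'m \<Rightarrow> complex^'n^'m" where
  "cscale c A = (\<chi> i j. c * A $ i $ j)"

global_interpretation cmat: vector_space "cscale :: complex \<Rightarrow> complex^'n^'m \<Rightarrow> complex^'n^'m"
  by unfold_locales (simp_all add: cscale_def vec_eq_iff algebra_simps)

definition bracket :: "complex^'n^'n \<Rightarrow> complex^'n^'n \<Rightarrow> complex^'n^'n" where
  "bracket A B = A ** B - B ** A"

definition lie_subalgebra :: "(complex^'n^'n) set \<Rightarrow> (complex^'n^'n) set \<Rightarrow> bool" where
  "lie_subalgebra \<gg> \<hh> \<longleftrightarrow>
     \<hh> \<subseteq> \<gg> \<and> cmat.subspace \<hh> \<and> (\<forall>X\<in>\<hh>. \<forall>Y\<in>\<hh>. bracket X Y \<in> \<hh>)"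

definition derived_algebra :: "(complex^'n^'n) set \<Rightarrow> (complex^'n^'n) set" where
  "derived_algebra \<hh> = cmat.span {bracket X Y | X Y. X \<in> \<hh> \<and> Y \<in> \<hh>}"

definition solvable_algebra :: "(complex^'n^'n) set \<Rightarrow> bool" where
  "solvable_algebra \<hh> \<longleftrightarrow> (\<exists>k. (derived_algebra ^^ k) \<hh> = {0})"

definition borel_subalgebra :: "(complex^'n^'n) set \<Rightarrow> (complex^'n^'n) set \<Rightarrow> bool" where
  "borel_subalgebra \<gg> \<bb> \<longleftrightarrow>
     lie_subalgebra \<gg> \<bb> \<and> solvable_algebra \<bb> \<and>
     (\<forall>\<cc>. lie_subalgebra \<gg> \<cc> \<and> solvable_algebra \<cc> \<and> \<bb> \<subseteq> \<cc> \<longrightarrow> \<cc> = \<bb>)"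

definition ad_semisimple :: "(complex^'n^'n) set \<Rightarrow> complex^'n^'n \<Rightarrow> bool" where
  "ad_semisimple \<gg> H \<longleftrightarrow> \<gg> \<subseteq> cmat.span {X \<in> \<gg>. \<exists>c. bracket H X = cscale c X}"

definition nonneg_ad_part :: "(complex^'n^'n) set \<Rightarrow> complex^'n^'n \<Rightarrow> (complex^'n^'n) set" where
  "nonneg_ad_part \<gg> H = cmat.span {X \<in> \<gg>. \<exists>c \<in> \<real>\<^sub>\<ge>\<^sub>0. bracket H X = cscale c X}"

text \<open>Functionals on \<open>\<tt>\<close> are functions on all matrices of which only the values on \<open>\<tt>\<close> matter.\<close>

definition linear_form_on :: "(complex^'n^'n) set \<Rightarrow> (complex^'n^'n \<Rightarrow> complex) \<Rightarrow> bool" where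
  "linear_form_on \<tt> \<sigma> \<longleftrightarrow>
     (\<forall>X\<in>\<tt>. \<forall>Y\<in>\<tt>. \<sigma> (X + Y) = \<sigma> X + \<sigma> Y) \<and>
     (\<forall>c. \<forall>X\<in>\<tt>. \<sigma> (cscale c X) = c * \<sigma> X)"

definition root_space ::
  "(complex^'n^'n) set \<Rightarrow> (complex^'n^'n) set \<Rightarrow> (complex^'n^'n \<Rightarrow> complex) \<Rightarrow> (complex^'n^'n) set" where
  "root_space \<gg> \<tt> \<sigma> = {X \<in> \<gg>. \<forall>H\<in>\<tt>. bracket H X = cscale (\<sigma> H) X}"

definition root ::
  "(complex^'n^'n) set \<Rightarrow> (complex^'n^'n) set \<Rightarrow> (complex^'n^'n \<Rightarrow> complex) \<Rightarrow> bool" where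
  "root \<gg> \<tt> \<sigma> \<longleftrightarrow>
     linear_form_on \<tt> \<sigma> \<and> (\<exists>H\<in>\<tt>. \<sigma> H \<noteq> 0) \<and> (\<exists>X \<in> root_space \<gg> \<tt> \<sigma>. X \<noteq> 0)"

definition positive_root ::
  "(complex^'n^'n) set \<Rightarrow> (complex^'n^'n) set \<Rightarrow> (complex^'n^'n) set \<Rightarrow>
   (complex^'n^'n \<Rightarrow> complex) \<Rightarrow> bool" where
  "positive_root \<gg> \<tt> \<bb> \<sigma> \<longleftrightarrow> root \<gg> \<tt> \<sigma> \<and> root_space \<gg> \<tt> \<sigma> \<subseteq> \<bb>"

definition simple_root ::
  "(complex^'n^'n) set \<Rightarrow> (complex^'n^'n) set \<Rightarrow> (complex^'n^'n) set \<Rightarrow>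
   (complex^'n^'n \<Rightarrow> complex) \<Rightarrow> bool" where
  "simple_root \<gg> \<tt> \<bb> \<sigma> \<longleftrightarrow>
     positive_root \<gg> \<tt> \<bb> \<sigma> \<and>
     \<not> (\<exists>\<alpha> \<beta>. positive_root \<gg> \<tt> \<bb> \<alpha> \<and> positive_root \<gg> \<tt> \<bb> \<beta> \<and>
              (\<forall>H\<in>\<tt>. \<sigma> H = \<alpha> H + \<beta> H))"

subsection \<open>Linear algebraic groups\<close>

inductive_set poly_algebra :: "complex set \<Rightarrow> ('a \<Rightarrow> complex) set \<Rightarrow> ('a \<Rightarrow> complex) set"
  for K :: "complex set" and \<X> :: "('a \<Rightarrow> complex) set" where
  const: "c \<in> K \<Longrightarrow> (\<lambda>_. c) \<in> poly_algebra K \<X>"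
| coord: "f \<in> \<X> \<Longrightarrow> f \<in> poly_algebra K \<X>"
| add: "f \<in> poly_algebra K \<X> \<Longrightarrow> g \<in> poly_algebra K \<X> \<Longrightarrow> (\<lambda>x. f x + g x) \<in> poly_algebra K \<X>"
| mult: "f \<in> poly_algebra K \<X> \<Longrightarrow> g \<in> poly_algebra K \<X> \<Longrightarrow> (\<lambda>x. f x * g x) \<in> poly_algebra K \<X>"

definition entry_funs :: "(complex^'n^'n \<Rightarrow> complex) set" where
  "entry_funs = {(\<lambda>g. g $ i $ j) | i j. True}"

definition polynomial_funs :: "complex set \<Rightarrow> (complex^'n^'n \<Rightarrow> complex) set" where
  "polynomial_funs K = poly_algebra K entry_funs"

text \<open>Regular functions on \<open>GL\<^sub>n\<close>: the algebra \<open>K[g\<^sub>i\<^sub>j, 1/det]\<close>.\<close>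

definition regular_funs :: "complex set \<Rightarrow> (complex^'n^'n \<Rightarrow> complex) set" where
  "regular_funs K = poly_algebra K (insert (\<lambda>g. inverse (det g)) entry_funs)"

definition algebraic_group :: "complex set \<Rightarrow> (complex^'n^'n) set \<Rightarrow> bool" where
  "algebraic_group K G \<longleftrightarrow>
     (\<exists>F \<subseteq> polynomial_funs K. G = {g. invertible g \<and> (\<forall>f\<in>F. f g = 0)}) \<and>
     mat 1 \<in> G \<and> (\<forall>g\<in>G. \<forall>h\<in>G. g ** h \<in> G) \<and> (\<forall>g\<in>G. matrix_inv g \<in> G)"

definition real_matrices :: "(complex^'n^'m) set" where
  "real_matrices = {A. \<forall>i j. A $ i $ j \<in> \<real>}"

definition algebraic_hom ::
  "complex set \<Rightarrow> (complex^'n^'n) set \<Rightarrow> (complex^'m^'m) set \<Rightarrow>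
   (complex^'n^'n \<Rightarrow> complex^'m^'m) \<Rightarrow> bool" where
  "algebraic_hom K G H \<pi> \<longleftrightarrow>
     \<pi> ` G \<subseteq> H \<and> (\<forall>g\<in>G. \<forall>h\<in>G. \<pi> (g ** h) = \<pi> g ** \<pi> h) \<and>
     (\<forall>i j. \<exists>f \<in> regular_funs K. \<forall>g\<in>G. \<pi> g $ i $ j = f g)"

text \<open>
  The circle is the real algebraic group with coordinate ring \<open>\<real>[x,y]/(x\<^sup>2 + y\<^sup>2 - 1)\<close>; since its
  real points are Zariski dense, homomorphisms of real algebraic groups out of it are given by
  their effect on real points.
\<close>

definition circle :: "complex set" where
  "circle = {z. cmod z = 1}"

definition circle_hom :: "(complex^'n^'n) set \<Rightarrow> (complex \<Rightarrow> complex^'n^'n) \<Rightarrow> bool" where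
  "circle_hom G \<phi> \<longleftrightarrow>
     \<phi> ` circle \<subseteq> G \<inter> real_matrices \<and>
     (\<forall>z\<in>circle. \<forall>u\<in>circle. \<phi> (z * u) = \<phi> z ** \<phi> u) \<and>
     (\<forall>i j. \<exists>f \<in> poly_algebra \<real> {\<lambda>z. of_real (Re z), \<lambda>z. of_real (Im z)}.
        \<forall>z\<in>circle. \<phi> z $ i $ j = f z)"

definition nonconstant_on_circle :: "(complex \<Rightarrow> 'a) \<Rightarrow> bool" where
  "nonconstant_on_circle \<phi> \<longleftrightarrow> (\<exists>z\<in>circle. \<exists>u\<in>circle. \<phi> z \<noteq> \<phi> u)"

definition tangent_derivative :: "(complex^'n^'n \<Rightarrow> complex) \<Rightarrow> complex^'n^'n \<Rightarrow> complex" where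
  "tangent_derivative f X = deriv (\<lambda>t. f (mat 1 + cscale t X)) 0"

text \<open>The complex Lie algebra of \<open>G\<close>, as the Zariski tangent space at the identity.\<close>

definition lie_algebra :: "(complex^'n^'n) set \<Rightarrow> (complex^'n^'n) set" where
  "lie_algebra G =
     {X. \<forall>f \<in> polynomial_funs UNIV. (\<forall>g\<in>G. f g = 0) \<longrightarrow> tangent_derivative f X = 0}"

text \<open>
  The differential at the identity of a morphism defined on \<open>G\<close> only. It is computed from any
  extensions of the entries of \<open>\<pi>\<close> to regular functions on \<open>GL\<^sub>n\<close>; on the Lie algebra of \<open>G\<close> the
  result does not depend on the extensions.
\<close>

definition differential ::
  "(complex^'n^'n) set \<Rightarrow> (complex^'n^'n \<Rightarrow> complex^'m^'m) \<Rightarrow> complex^'n^'n \<Rightarrow> complex^'m^'m" where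
  "differential G \<pi> X =
     (\<chi> i j. THE d. \<forall>f \<in> regular_funs UNIV.
        (\<forall>g\<in>G. f g = \<pi> g $ i $ j) \<longrightarrow> tangent_derivative f X = d)"

text \<open>
  Tori are the connected diagonalizable groups. For the complex points of an algebraic group,
  connectedness in the classical topology agrees with Zariski connectedness.
\<close>

definition real_torus :: "(complex^'n^'n) set \<Rightarrow> bool" where
  "real_torus S \<longleftrightarrow>
     algebraic_group \<real> S \<and> connected S \<and>
     (\<exists>P :: complex^'n^'n. invertible P \<and>
        (\<forall>g\<in>S. \<forall>i j. i \<noteq> j \<longrightarrow> (P ** g ** matrix_inv P) $ i $ j = 0))"

definition compact_maximal_torus :: "(complex^'n^'n) set \<Rightarrow> (complex^'n^'n) set \<Rightarrow> bool" where
  "compact_maximal_torus G S \<longleftrightarrow>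
     real_torus S \<and> S \<subseteq> G \<and> compact (S \<inter> real_matrices) \<and>
     (\<forall>S'. real_torus S' \<and> S' \<subseteq> G \<and> S \<subseteq> S' \<longrightarrow> S' = S)"

subsection \<open>Hodge representations\<close>

definition nondegenerate_form :: "int \<Rightarrow> (rat^'v \<Rightarrow> rat^'v \<Rightarrow> rat) \<Rightarrow> bool" where
  "nondegenerate_form w Q \<longleftrightarrow>
     (\<forall>u. Vector_Spaces.linear (*s) (*) (Q u)) \<and>
     (\<forall>v. Vector_Spaces.linear (*s) (*) (\<lambda>u. Q u v)) \<and>
     (\<forall>u v. Q u v = (-1) powi w * Q v u) \<and>
     (\<forall>u. u \<noteq> 0 \<longrightarrow> (\<exists>v. Q u v \<noteq> 0))"

definition complex_form ::
  "(rat^'v \<Rightarrow> rat^'v \<Rightarrow> rat) \<Rightarrow> complex^'v \<Rightarrow> complex^'v \<Rightarrow> complex" where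
  "complex_form Q u v =
     (\<Sum>i\<in>UNIV. \<Sum>j\<in>UNIV. u $ i * v $ j * of_rat (Q (axis i 1) (axis j 1)))"

definition aut_form :: "(rat^'v \<Rightarrow> rat^'v \<Rightarrow> rat) \<Rightarrow> (complex^'v^'v) set" where
  "aut_form Q =
     {g. invertible g \<and> (\<forall>u v. complex_form Q (g *v u) (g *v v) = complex_form Q u v)}"

definition vec_cnj :: "complex^'v \<Rightarrow> complex^'v" where
  "vec_cnj v = (\<chi> i. cnj (v $ i))"

definition polarized_hodge_structure ::
  "int \<Rightarrow> (rat^'v \<Rightarrow> rat^'v \<Rightarrow> rat) \<Rightarrow> (complex \<Rightarrow> complex^'v^'v) \<Rightarrow> bool" where
  "polarized_hodge_structure w Q \<phi> \<longleftrightarrow>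
     circle_hom (aut_form Q) \<phi> \<and> nonconstant_on_circle \<phi> \<and>
     \<phi> (-1) = mat ((-1) powi w) \<and>
     (\<forall>v. v \<noteq> 0 \<longrightarrow>
        complex_form Q v (\<phi> \<i> *v vec_cnj v) \<in> \<real> \<and>
        0 < Re (complex_form Q v (\<phi> \<i> *v vec_cnj v)))"

definition hodge_space :: "(complex \<Rightarrow> complex^'v^'v) \<Rightarrow> int \<Rightarrow> int \<Rightarrow> (complex^'v) set" where
  "hodge_space \<phi> p q = {v. \<forall>z\<in>circle. \<phi> z *v v = (z powi (p - q)) *s v}"

definition hodge_representation ::
  "(complex^'n^'n) set \<Rightarrow> int \<Rightarrow> (rat^'v \<Rightarrow> rat^'v \<Rightarrow> rat) \<Rightarrow>
   (complex^'n^'n \<Rightarrow> complex^'v^'v) \<Rightarrow> (complex \<Rightarrow> complex^'n^'n) \<Rightarrow> bool" where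
  "hodge_representation G w Q \<pi> \<phi> \<longleftrightarrow>
     algebraic_group \<rat> G \<and> nondegenerate_form w Q \<and>
     algebraic_hom \<rat> G (aut_form Q) \<pi> \<and> inj_on (differential G \<pi>) (lie_algebra G) \<and>
     circle_hom G \<phi> \<and> nonconstant_on_circle \<phi> \<and>
     polarized_hodge_structure w Q (\<pi> \<circ> \<phi>)"

definition grading_element ::
  "(complex^'n^'n) set \<Rightarrow> int \<Rightarrow> (complex^'n^'n \<Rightarrow> complex^'v^'v) \<Rightarrow>
   (complex \<Rightarrow> complex^'n^'n) \<Rightarrow> complex^'n^'n" where
  "grading_element G w \<pi> \<phi> =
     (THE H. H \<in> cscale \<i> ` (lie_algebra G \<inter> real_matrices) \<and>
        ad_semisimple (lie_algebra G) H \<and>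
        (\<forall>p q. p + q = w \<longrightarrow> (\<forall>v \<in> hodge_space (\<pi> \<circ> \<phi>) p q.
           differential G \<pi> H *v v = (of_int (p - q) / 2) *s v)))"

definition grading_eigenspace ::
  "(complex^'n^'n) set \<Rightarrow> int \<Rightarrow> (complex^'n^'n \<Rightarrow> complex^'v^'v) \<Rightarrow>
   (complex \<Rightarrow> complex^'n^'n) \<Rightarrow> real \<Rightarrow> (complex^'v) set" where
  "grading_eigenspace G w \<pi> \<phi> l =
     {v. differential G \<pi> (grading_element G w \<pi> \<phi>) *v v = complex_of_real l *s v}"

text \<open>The half-integer \<open>m\<close> is the largest eigenvalue, and \<open>l\<close> runs through \<open>m, m - 1, ..., -m\<close>.\<close>

definition principal_representation ::
  "(complex^'n^'n) set \<Rightarrow> int \<Rightarrow> (complex^'n^'n \<Rightarrow> complex^'v^'v) \<Rightarrow>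
   (complex \<Rightarrow> complex^'n^'n) \<Rightarrow> bool" where
  "principal_representation G w \<pi> \<phi> \<longleftrightarrow>
     (let m = Max {l. grading_eigenspace G w \<pi> \<phi> l \<noteq> {0}} in
      \<forall>k::nat. - m \<le> m - real k \<longrightarrow> vec.dim (grading_eigenspace G w \<pi> \<phi> (m - real k)) = 1)"

subsection \<open>The Lie algebra \<open>sl\<^sub>2\<close> and symmetric powers of its standard representation\<close>

definition sl2 :: "(complex^2^2) set" where
  "sl2 = {A. trace A = 0}"

definition lie_iso ::
  "(complex^'n^'n) set \<Rightarrow> (complex^'m^'m) set \<Rightarrow> (complex^'n^'n \<Rightarrow> complex^'m^'m) \<Rightarrow> bool" where
  "lie_iso \<gg> \<hh> \<theta> \<longleftrightarrow>
     bij_betw \<theta> \<gg> \<hh> \<and>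
     (\<forall>X\<in>\<gg>. \<forall>Y\<in>\<gg>. \<theta> (X + Y) = \<theta> X + \<theta> Y) \<and>
     (\<forall>c. \<forall>X\<in>\<gg>. \<theta> (cscale c X) = cscale c (\<theta> X)) \<and>
     (\<forall>X\<in>\<gg>. \<forall>Y\<in>\<gg>. \<theta> (bracket X Y) = bracket (\<theta> X) (\<theta> Y))"

text \<open>
  The symmetric algebra of \<open>\<complex>\<^sup>2\<close> is the polynomial ring in the standard basis vectors \<open>e\<^sub>1, e\<^sub>2\<close>, here
  the inner and the outer variable of \<^typ>\<open>complex poly poly\<close>. A matrix acts as the derivation
  extending its action on the linear forms.
\<close>

definition sym_power :: "nat \<Rightarrow> complex poly poly set" where
  "sym_power p = {P. \<forall>i j. coeff (coeff P j) i \<noteq> 0 \<longrightarrow> i + j = p}"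

definition sym_linear :: "complex^2 \<Rightarrow> complex poly poly" where
  "sym_linear u = [:[:0, u $ 1:], [:u $ 2:]:]"

definition sym_action :: "complex^2^2 \<Rightarrow> complex poly poly \<Rightarrow> complex poly poly" where
  "sym_action A P =
     sym_linear (A *v axis 1 1) * map_poly pderiv P + sym_linear (A *v axis 2 1) * pderiv P"

definition is_sym_power_rep ::
  "(complex^'n^'n) set \<Rightarrow> (complex^'n^'n \<Rightarrow> complex^2^2) \<Rightarrow>
   (complex^'n^'n \<Rightarrow> complex^'v^'v) \<Rightarrow> nat \<Rightarrow> bool" where
  "is_sym_power_rep \<gg> \<theta> \<rho> p \<longleftrightarrow>
     (\<exists>\<Psi> :: complex^'v \<Rightarrow> complex poly poly.
        bij_betw \<Psi> UNIV (sym_power p) \<and>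
        (\<forall>u v. \<Psi> (u + v) = \<Psi> u + \<Psi> v) \<and> (\<forall>c v. \<Psi> (c *s v) = smult [:c:] (\<Psi> v)) \<and>
        (\<forall>X\<in>\<gg>. \<forall>v. \<Psi> (\<rho> X *v v) = sym_action (\<theta> X) (\<Psi> v)))"

end

theory Submission
  imports Defs
begin

text \<open>
  Expanding \<open>\<phi>\<close> in characters of the circle, \<open>\<phi>(z) = \<Sum>\<^sub>k z\<^sup>k A\<^sub>k\<close> with orthogonal idempotents \<open>A\<^sub>k\<close>,
  identifies the grading element with \<open>H = \<Sum>\<^sub>k (k/2) A\<^sub>k\<close>, a multiple of the velocity of \<open>\<phi>\<close> at the
  identity. Its image in \<open>sl\<^sub>2\<close> is nonzero and squares to a scalar \<open>a\<^sup>2\<close>; since \<open>H\<close> acts diagonalizably on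
  the symmetric power, \<open>a \<noteq> 0\<close>, and the products of powers of two eigenvectors show that the spectrum
  on \<open>V\<close> is \<open>a (p - 2j)\<close> for \<open>j = 0, ..., p\<close>, without multiplicities. All weights of \<open>V\<close> have the
  parity of \<open>w\<close>, so \<open>2a\<close> is an integer, and the representation is principal iff the spacing \<open>2\<bar>a\<bar>\<close>
  of the spectrum is \<open>1\<close>. On the other hand, \<open>\<sigma>\<^sub>1(H)\<close> is a nonnegative nonzero eigenvalue of \<open>ad H\<close>, hence
  equal to \<open>2\<bar>a\<bar>\<close>, and \<open>\<tt>\<close> is the line spanned by \<open>H\<close>, so \<open>H = T\<^sub>1\<close> iff \<open>\<sigma>\<^sub>1(H) = 1\<close>.
\<close>

section \<open>Characters of the circle\<close>

lemma cscale_component [simp]: "cscale c A $ i $ j = c * A $ i $ j"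
  by (simp add: cscale_def)

lemma cscale_matrix_mult: "cscale c A ** B = cscale c (A ** B)" "A ** cscale c B = cscale c (A ** B)"
  by (simp_all add: vec_eq_iff matrix_matrix_mult_def sum_distrib_left mult_ac)

lemma cscale_mult_vec: "cscale c A *v v = c *s (A *v v)"
  by (simp add: vec_eq_iff matrix_vector_mult_def sum_distrib_left mult_ac)

lemma matrix_mult_add_right: "(A + B) ** (C :: complex^'n^'n) = A ** C + B ** C"
  by (simp add: vec_eq_iff matrix_matrix_mult_def sum.distrib distrib_right)

lemma sum_matrix_mult: "(\<Sum>k\<in>I. f k) ** B = (\<Sum>k\<in>I. f k ** (B :: complex^'n^'n))"
  by (induction I rule: infinite_finite_induct) (simp_all add: matrix_mult_add_right)

lemma matrix_mult_sum_right: "B ** (\<Sum>k\<in>I. f k) = (\<Sum>k\<in>I. (B :: complex^'n^'n) ** f k)"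
  by (induction I rule: infinite_finite_induct) (simp_all add: matrix_add_ldistrib)

lemma sum_matrix_mult_vec: "(\<Sum>k\<in>I. f k) *v v = (\<Sum>k\<in>I. (f k :: complex^'n^'n) *v v)"
  by (induction I rule: infinite_finite_induct) (simp_all add: matrix_vector_mult_add_rdistrib)

lemma infinite_circle: "infinite circle"
proof
  assume fin: "finite circle"
  have "inj_on cis {0..<2*pi}"
    by (rule inj_onI) (metis Arg2pi_unique atLeastLessThan_iff cis_conv_exp mult.left_neutral of_real_1 zero_less_one)
  moreover have "cis ` {0..<2*pi} \<subseteq> circle" by (auto simp: circle_def)
  ultimately have "finite {0..<2*pi}"
    using fin by (meson finite_imageD finite_subset)
  then show False using infinite_Ico[of 0 "2*pi"] pi_gt_zero by auto
qed

lemma circle_simps [simp]: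
  "1 \<in> circle" "-1 \<in> circle" "cis t \<in> circle"
  "z \<in> circle \<Longrightarrow> u \<in> circle \<Longrightarrow> z * u \<in> circle"
  "z \<in> circle \<Longrightarrow> inverse z \<in> circle"
  by (auto simp: circle_def norm_mult norm_inverse)

lemma circle_nonzero: "z \<in> circle \<Longrightarrow> z \<noteq> 0"
  by (auto simp: circle_def)

text \<open>Multiplication by \<open>z ^ n\<close>, with \<open>n\<close> bounding all exponents in
  absolute value, turns the Laurent sum into an ordinary polynomial. It has the infinitely many
  points of the circle as roots, so all its coefficients vanish.\<close>

lemma laurent_zero_on_circle:
  fixes c :: "int \<Rightarrow> complex"
  assumes fin: "finite I" and zero: "\<And>z. z \<in> circle \<Longrightarrow> (\<Sum>k\<in>I. c k * z powi k) = 0" and "k \<in> I"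
  shows "c k = 0"
proof -
  obtain n :: nat where n: "\<And>k. k \<in> I \<Longrightarrow> \<bar>k\<bar> \<le> int n"
  proof -
    have "\<bar>k\<bar> \<le> int (nat (\<Sum>k\<in>I. \<bar>k\<bar>))" if "k \<in> I" for k
      using member_le_sum[of k I abs] that fin by (simp add: sum_nonneg)
    then show ?thesis using that by blast
  qed
  define P where "P = (\<Sum>k\<in>I. monom (c k) (nat (k + int n)))"
  have "poly P z = 0" if "z \<in> circle" for z
  proof -
    have "poly P z = (\<Sum>k\<in>I. c k * z ^ nat (k + int n))"
      by (simp add: P_def poly_sum poly_monom)
    also have "\<dots> = (\<Sum>k\<in>I. z ^ n * (c k * z powi k))"
    proof (rule sum.cong)
      fix k assume "k \<in> I"
      then have "0 \<le> k + int n" using n[of k] by linarith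
      then have "z ^ nat (k + int n) = z powi (k + int n)" by (simp add: power_int_def)
      also have "\<dots> = z powi k * z ^ n"
        using circle_nonzero[OF that] by (simp add: power_int_add)
      finally show "c k * z ^ nat (k + int n) = z ^ n * (c k * z powi k)" by simp
    qed simp
    finally show ?thesis using zero[OF that] by (simp flip: sum_distrib_left)
  qed
  then have "infinite {z. poly P z = 0}"
    by (intro infinite_super[OF _ infinite_circle]) auto
  then have "P = 0" using poly_roots_finite by blast
  then have "0 = coeff P (nat (k + int n))" by simp
  also have "\<dots> = (\<Sum>l\<in>I. if l = k then c l else 0)"
    unfolding P_def coeff_sum coeff_monom
  proof (rule sum.cong)
    fix l assume "l \<in> I"
    then have "0 \<le> l + int n" "0 \<le> k + int n" using n[of l] n[of k] \<open>k \<in> I\<close> by linarith+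
    then show "(if nat (l + int n) = nat (k + int n) then c l else 0) = (if l = k then c l else 0)"
      by auto
  qed simp
  also have "\<dots> = c k" using fin \<open>k \<in> I\<close> by simp
  finally show ?thesis by simp
qed

text \<open>On the circle \<open>cnj z\<close> is the inverse of \<open>z\<close>, so the real and
  imaginary parts are Laurent polynomials in \<open>z\<close>; a power of \<open>z\<close> clears
  the denominators.\<close>

lemma circle_function_poly:
  assumes "f \<in> poly_algebra \<real> {\<lambda>z. complex_of_real (Re z), \<lambda>z. complex_of_real (Im z)}"
  shows "\<exists>n P. \<forall>z\<in>circle. f z * z ^ n = poly P z"
  using assms
proof induction
  case (const c)
  show ?case by (rule exI[of _ 0], rule exI[of _ "[:c:]"]) simp
next
  case (coord f)
  have conj: "cnj z * z = 1" if "z \<in> circle" for z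
    using that complex_norm_square[of z] by (simp add: circle_def mult.commute)
  have Re: "of_real (Re z) = (z + cnj z) / 2" and Im: "of_real (Im z) = (z - cnj z) / (2 * \<i>)" for z
    by (simp_all add: complex_eq_iff)
  have "of_real (Re z) * z ^ 1 = poly [:1/2, 0, 1/2:] z" if "z \<in> circle" for z
    using conj[OF that] by (simp add: Re field_simps)
  moreover have "of_real (Im z) * z ^ 1 = poly [:-1/(2*\<i>), 0, 1/(2*\<i>):] z" if "z \<in> circle" for z
    using conj[OF that] by (simp add: Im field_simps)
  ultimately show ?case using coord by blast
next
  case (add f g)
  then obtain n P m R where
    *: "\<And>z. z \<in> circle \<Longrightarrow> f z * z ^ n = poly P z" "\<And>z. z \<in> circle \<Longrightarrow> g z * z ^ m = poly R z"
    by blast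
  then have "(f z + g z) * z ^ (n + m) = poly (P * monom 1 m + R * monom 1 n) z"
    if "z \<in> circle" for z
    using that by (simp add: poly_monom power_add algebra_simps flip: *)
  then show ?case by blast
next
  case (mult f g)
  then obtain n P m R where
    *: "\<And>z. z \<in> circle \<Longrightarrow> f z * z ^ n = poly P z" "\<And>z. z \<in> circle \<Longrightarrow> g z * z ^ m = poly R z"
    by blast
  then have "(f z * g z) * z ^ (n + m) = poly (P * R) z" if "z \<in> circle" for z
    using that by (simp add: power_add algebra_simps flip: *)
  then show ?case by blast
qed

text \<open>The expansion is stated for every sufficiently large symmetric window of exponents, so
  that a single window can serve all entries of a matrix at once.\<close>

lemma circle_function_laurent:
  assumes "f \<in> poly_algebra \<real> {\<lambda>z. complex_of_real (Re z), \<lambda>z. complex_of_real (Im z)}"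
  shows "\<exists>c N. \<forall>n\<ge>N. \<forall>z\<in>circle. f z = (\<Sum>k\<in>{-int n..int n}. c k * z powi k)"
proof -
  obtain m P where P: "\<And>z. z \<in> circle \<Longrightarrow> f z * z ^ m = poly P z"
    using circle_function_poly[OF assms] by blast
  \<comment> \<open>Below \<open>- int m\<close> the index \<open>nat (k + int m)\<close> would
    collapse to \<open>0\<close>, so the coefficient there is set to zero explicitly.\<close>
  define c where "c k = (if k < - int m then 0 else coeff P (nat (k + int m)))" for k
  have "f z = (\<Sum>k\<in>{-int n..int n}. c k * z powi k)" if n: "n \<ge> m + degree P" and z: "z \<in> circle" for n z
  proof -
    have nz: "z \<noteq> 0" using circle_nonzero[OF z] .
    have "f z = poly P z / z ^ m" using P[OF z] nz by (simp add: field_simps)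
    also have "\<dots> = (\<Sum>i\<le>degree P. coeff P i * z powi (int i - int m))"
      using nz by (simp add: poly_altdef sum_divide_distrib power_int_diff)
    also have "\<dots> = (\<Sum>k\<in>(\<lambda>i. int i - int m) ` {..degree P}. c k * z powi k)"
      by (subst sum.reindex) (auto simp: inj_on_def c_def)
    also have "\<dots> = (\<Sum>k\<in>{-int n..int n}. c k * z powi k)"
    proof (rule sum.mono_neutral_left)
      show "\<forall>k\<in>{- int n..int n} - (\<lambda>i. int i - int m) ` {..degree P}. c k * z powi k = 0"
      proof
        fix k assume k: "k \<in> {- int n..int n} - (\<lambda>i. int i - int m) ` {..degree P}"
        have "c k = 0"
        proof (cases "k < - int m")
          case False
          then have "k = int (nat (k + int m)) - int m" by simp
          then have "nat (k + int m) \<notin> {..degree P}" using k by blast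
          then show ?thesis by (simp add: c_def coeff_eq_0)
        qed (simp add: c_def)
        then show "c k * z powi k = 0" by simp
      qed
    qed (use n in auto)
    finally show ?thesis .
  qed
  then show ?thesis by blast
qed

text \<open>The \<open>A k\<close> are the projections onto the weight spaces of
  \<open>\<phi>\<close>. Some of them may be zero, so \<open>I\<close> can be larger than the set of
  weights; statements about actual weights carry \<open>A k \<noteq> 0\<close>.\<close>

definition weight_projections ::
  "(complex \<Rightarrow> complex^'n^'n) \<Rightarrow> int set \<Rightarrow> (int \<Rightarrow> complex^'n^'n) \<Rightarrow> bool" where
  "weight_projections \<phi> I A \<longleftrightarrow>
     finite I \<and> (\<forall>z\<in>circle. \<phi> z = (\<Sum>k\<in>I. cscale (z powi k) (A k))) \<and>
     (\<forall>k\<in>I. \<forall>l\<in>I. A k ** A l = (if k = l then A k else 0)) \<and> (\<Sum>k\<in>I. A k) = mat 1"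

text \<open>The Laurent coefficients of \<phi> are orthogonal idempotents: this is what
  multiplicativity says when the coefficients of \<open>z powi k * u powi l\<close> are
  compared.\<close>

lemma circle_hom_weight_projections:
  assumes hom: "circle_hom G \<phi>" and inv: "\<And>g. g \<in> G \<Longrightarrow> invertible g"
  shows "\<exists>I A. weight_projections \<phi> I A"
proof -
  have mult: "\<phi> (z * u) = \<phi> z ** \<phi> u" if "z \<in> circle" "u \<in> circle" for z u
    using hom that by (simp add: circle_hom_def)
  have "\<forall>i j. \<exists>c N. \<forall>n\<ge>N. \<forall>z\<in>circle. \<phi> z $ i $ j = (\<Sum>k\<in>{-int n..int n}. c k * z powi k)"
  proof (intro allI)
    fix i j
    obtain f where f: "f \<in> poly_algebra \<real> {\<lambda>z. of_real (Re z), \<lambda>z. of_real (Im z)}"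
      "\<And>z. z \<in> circle \<Longrightarrow> \<phi> z $ i $ j = f z"
      using hom unfolding circle_hom_def by blast
    show "\<exists>c N. \<forall>n\<ge>N. \<forall>z\<in>circle. \<phi> z $ i $ j = (\<Sum>k\<in>{-int n..int n}. c k * z powi k)"
      using circle_function_laurent[OF f(1)] f(2) by simp
  qed
  then obtain c N where cN: "\<And>i j n z. n \<ge> N i j \<Longrightarrow> z \<in> circle \<Longrightarrow>
      \<phi> z $ i $ j = (\<Sum>k\<in>{-int n..int n}. c i j k * z powi k)"
    by metis
  \<comment> \<open>A sum of natural numbers dominates each term, so this \<open>n\<close> is a
    common bound for all entries.\<close>
  define n where "n = (\<Sum>i\<in>UNIV. \<Sum>j\<in>UNIV. N i j)"
  have n: "N i j \<le> n" for i j
  proof -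
    have "N i j \<le> (\<Sum>j\<in>UNIV. N i j)" by (rule member_le_sum) auto
    also have "\<dots> \<le> n" unfolding n_def by (rule member_le_sum) auto
    finally show ?thesis .
  qed
  define I where "I = {-int n..int n}"
  define A where "A k = (\<chi> i j. c i j k)" for k
  have phi: "\<phi> z = (\<Sum>k\<in>I. cscale (z powi k) (A k))" if "z \<in> circle" for z
    using cN[OF n that] by (simp add: vec_eq_iff A_def I_def mult.commute)
  have finI: "finite I" by (simp add: I_def)
  have orth: "A k ** A l = (if k = l then A k else 0)" if kl: "k \<in> I" "l \<in> I" for k l
  proof -
    \<comment> \<open>The uniqueness of Laurent coefficients is used twice: first in
      \<open>z\<close> with \<open>u\<close> fixed, which leaves for each \<open>k\<close> a Laurent
      sum in \<open>u\<close>, and then in \<open>u\<close>.\<close>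
    have 1: "(\<Sum>l\<in>I. ((A k ** A l) $ i $ j - (if k = l then A k $ i $ j else 0)) * u powi l) = 0"
      if u: "u \<in> circle" and k: "k \<in> I" for u i j k
    proof (rule laurent_zero_on_circle[OF finI _ k])
      fix z assume z: "z \<in> circle"
      have "(\<Sum>k\<in>I. (\<Sum>l\<in>I. ((A k ** A l) $ i $ j - (if k = l then A k $ i $ j else 0)) * u powi l) * z powi k)
        = (\<Sum>k\<in>I. \<Sum>l\<in>I. (z powi k * (u powi l * (A k ** A l) $ i $ j)))
          - (\<Sum>k\<in>I. \<Sum>l\<in>I. if k = l then A k $ i $ j * u powi l * z powi k else 0)"
        unfolding sum_distrib_right sum_subtractf[symmetric]
        by (intro sum.cong) (auto simp: algebra_simps)
      also have "(\<Sum>k\<in>I. \<Sum>l\<in>I. if k = l then A k $ i $ j * u powi l * z powi k else 0) =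
         (\<Sum>k\<in>I. A k $ i $ j * u powi k * z powi k)"
        by (simp add: finI)
      also have "\<dots> = \<phi> (z * u) $ i $ j"
        using z u by (simp add: phi power_int_mult_distrib mult_ac)
      also have "(\<Sum>k\<in>I. \<Sum>l\<in>I. (z powi k * (u powi l * (A k ** A l) $ i $ j))) = (\<phi> z ** \<phi> u) $ i $ j"
        using z u sum.swap[of "\<lambda>l k. z powi k * (u powi l * (A k ** A l) $ i $ j)" I I]
        by (simp add: phi sum_matrix_mult matrix_mult_sum_right cscale_matrix_mult sum_distrib_left mult_ac)
      also have "\<phi> z ** \<phi> u = \<phi> (z * u)" using mult z u by simp
      finally show "(\<Sum>k\<in>I. (\<Sum>l\<in>I. ((A k ** A l) $ i $ j - (if k = l then A k $ i $ j else 0)) * u powi l) * z powi k) = 0"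
        by simp
    qed
    have "(A k ** A l) $ i $ j - (if k = l then A k $ i $ j else 0) = 0" for i j
      using laurent_zero_on_circle[OF finI 1[OF _ \<open>k \<in> I\<close>] \<open>l \<in> I\<close>] by simp
    then show ?thesis by (auto simp: vec_eq_iff)
  qed
  \<comment> \<open>An idempotent that is invertible is the identity.\<close>
  have "\<phi> 1 \<in> G" using hom by (auto simp: circle_hom_def)
  then obtain g where g: "\<phi> 1 ** g = mat 1"
    using inv unfolding invertible_def by blast
  have "\<phi> 1 ** \<phi> 1 = \<phi> 1" using mult[of 1 1] by simp
  then have "\<phi> 1 = mat 1" by (metis g matrix_mul_assoc matrix_mul_rid)
  then have "(\<Sum>k\<in>I. A k) = mat 1" using phi[of 1] by simp
  then show ?thesis unfolding weight_projections_def using finI phi orth by blast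
qed

section \<open>Tangent spaces of matrix groups\<close>

text \<open>
  The complex lines through the identity compute \<open>tangent_derivative\<close>; the real curves are needed because
  \<open>\<phi>\<close> is only defined on the circle.
\<close>

definition has_tangent_map :: "(complex^'n^'n \<Rightarrow> complex) \<Rightarrow> (complex^'n^'n \<Rightarrow> complex) \<Rightarrow> bool" where
  "has_tangent_map f L \<longleftrightarrow>
     (\<forall>X Y. L (X + Y) = L X + L Y) \<and> (\<forall>c X. L (cscale c X) = c * L X) \<and>
     (\<forall>X. ((\<lambda>t. f (mat 1 + cscale t X)) has_field_derivative L X) (at 0)) \<and>
     (\<forall>\<gamma> X. \<gamma> (0::real) = mat 1 \<longrightarrow>
        (\<forall>i j. ((\<lambda>t. \<gamma> t $ i $ j) has_vector_derivative X $ i $ j) (at 0)) \<longrightarrow>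
        ((\<lambda>t. f (\<gamma> t)) has_vector_derivative L X) (at 0))"

lemma has_tangent_mapD:
  assumes "has_tangent_map f L"
  shows "L (X + Y) = L X + L Y" "L (cscale c X) = c * L X" "tangent_derivative f X = L X"
    "\<gamma> (0::real) = mat 1 \<Longrightarrow> (\<And>i j. ((\<lambda>t. \<gamma> t $ i $ j) has_vector_derivative X $ i $ j) (at 0)) \<Longrightarrow>
        ((\<lambda>t. f (\<gamma> t)) has_vector_derivative L X) (at 0)"
  using assms by (auto simp: has_tangent_map_def tangent_derivative_def intro: DERIV_imp_deriv)

lemma has_tangent_map_const: "has_tangent_map (\<lambda>_. c) (\<lambda>_. 0)"
  by (auto simp: has_tangent_map_def)

lemma has_tangent_map_entry: "has_tangent_map (\<lambda>g. g $ i $ j) (\<lambda>X. X $ i $ j)"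
  by (auto simp: has_tangent_map_def intro!: derivative_eq_intros)

lemma has_tangent_map_add:
  "has_tangent_map f L \<Longrightarrow> has_tangent_map g M \<Longrightarrow> has_tangent_map (\<lambda>x. f x + g x) (\<lambda>X. L X + M X)"
  by (auto simp: has_tangent_map_def algebra_simps intro!: derivative_intros)

lemma has_tangent_map_mult:
  assumes "has_tangent_map f L" "has_tangent_map g M"
  shows "has_tangent_map (\<lambda>x. f x * g x) (\<lambda>X. f (mat 1) * M X + L X * g (mat 1))"
proof -
  have [simp]: "cscale 0 X = 0" for X :: "complex^'n^'n" by (simp add: vec_eq_iff)
  have "((\<lambda>t. f (mat 1 + cscale t X) * g (mat 1 + cscale t X)) has_field_derivative
      (f (mat 1) * M X + L X * g (mat 1))) (at 0)" for X
    using assms unfolding has_tangent_map_def by (auto intro!: derivative_eq_intros)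
  moreover have "((\<lambda>t. f (\<gamma> t) * g (\<gamma> t)) has_vector_derivative
      (f (mat 1) * M X + L X * g (mat 1))) (at 0)"
    if "\<gamma> 0 = mat 1" "\<And>i j. ((\<lambda>t. \<gamma> t $ i $ j) has_vector_derivative X $ i $ j) (at 0)" for \<gamma> X
    using has_vector_derivative_mult[OF has_tangent_mapD(4)[OF assms(1) that]
        has_tangent_mapD(4)[OF assms(2) that]] that(1) by simp
  ultimately show ?thesis
    using assms unfolding has_tangent_map_def by (simp add: algebra_simps)
qed

text \<open>Meant for \<open>det\<close>, which is 1 at the identity; with that value the derivative
  of the reciprocal is the negative of the derivative.\<close>

lemma has_tangent_map_inverse:
  assumes "has_tangent_map f L" "f (mat 1) = 1"
  shows "has_tangent_map (\<lambda>x. inverse (f x)) (\<lambda>X. - L X)"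
proof -
  have [simp]: "cscale 0 X = 0" for X :: "complex^'n^'n" by (simp add: vec_eq_iff)
  have inv: "(inverse has_field_derivative -1) (at (1 :: complex))"
    by (auto intro!: derivative_eq_intros)
  have "((\<lambda>t. inverse (f (mat 1 + cscale t X))) has_field_derivative - L X) (at 0)" for X
    using assms unfolding has_tangent_map_def by (auto intro!: derivative_eq_intros)
  moreover have "((\<lambda>t. inverse (f (\<gamma> t))) has_vector_derivative - L X) (at 0)"
    if "\<gamma> 0 = mat 1" "\<And>i j. ((\<lambda>t. \<gamma> t $ i $ j) has_vector_derivative X $ i $ j) (at 0)" for \<gamma> X
    using field_vector_diff_chain_at[OF has_tangent_mapD(4)[OF assms(1) that], of inverse "-1"]
      inv that(1) assms(2) by (simp add: o_def)
  ultimately show ?thesis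
    using assms unfolding has_tangent_map_def by simp
qed

section \<open>Polynomial and regular functions have tangent maps\<close>

lemma poly_algebra_sum:
  assumes "0 \<in> K" "\<And>i. i \<in> I \<Longrightarrow> f i \<in> poly_algebra K \<X>"
  shows "(\<lambda>x. \<Sum>i\<in>I. f i x) \<in> poly_algebra K \<X>"
  using assms(2)
  by (induction I rule: infinite_finite_induct)
    (auto intro: poly_algebra.add poly_algebra.const[OF assms(1)])

lemma poly_algebra_prod:
  assumes "1 \<in> K" "\<And>i. i \<in> I \<Longrightarrow> f i \<in> poly_algebra K \<X>"
  shows "(\<lambda>x. \<Prod>i\<in>I. f i x) \<in> poly_algebra K \<X>"
  using assms(2)
  by (induction I rule: infinite_finite_induct)
    (auto intro: poly_algebra.mult poly_algebra.const[OF assms(1)])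

lemma poly_algebra_mono: "f \<in> poly_algebra K \<X> \<Longrightarrow> K \<subseteq> K' \<Longrightarrow> \<X> \<subseteq> \<X>' \<Longrightarrow> f \<in> poly_algebra K' \<X>'"
  by (induction rule: poly_algebra.induct) (auto intro: poly_algebra.intros)

lemma entry_polynomial: "(\<lambda>g. g $ i $ j) \<in> polynomial_funs K"
  by (auto simp: polynomial_funs_def entry_funs_def intro: poly_algebra.coord)

lemma polynomial_tangent_map: "f \<in> polynomial_funs UNIV \<Longrightarrow> \<exists>L. has_tangent_map f L"
  unfolding polynomial_funs_def
  by (induction rule: poly_algebra.induct)
    (auto simp: entry_funs_def intro: has_tangent_map_const has_tangent_map_entry
      has_tangent_map_add has_tangent_map_mult)

lemma det_polynomial: "(det :: complex^'n^'n \<Rightarrow> complex) \<in> polynomial_funs UNIV"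
  unfolding det_def polynomial_funs_def
  by (intro poly_algebra_sum poly_algebra.mult poly_algebra_prod poly_algebra.const
      entry_polynomial[unfolded polynomial_funs_def]) auto

lemma regular_tangent_map: "f \<in> regular_funs UNIV \<Longrightarrow> \<exists>L. has_tangent_map f L"
  unfolding regular_funs_def
proof (induction rule: poly_algebra.induct)
  case (coord f)
  obtain L where "has_tangent_map (det :: complex^'a^'a \<Rightarrow> complex) L"
    using polynomial_tangent_map[OF det_polynomial] by blast
  then have "has_tangent_map (\<lambda>g :: complex^'a^'a. inverse (det g)) (\<lambda>X. - L X)"
    by (rule has_tangent_map_inverse) simp
  with coord show ?case by (auto simp: entry_funs_def intro: has_tangent_map_entry)
qed (auto intro: has_tangent_map_const has_tangent_map_add has_tangent_map_mult)

section \<open>Lie algebras and differentials through tangent maps\<close>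

lemma lie_algebra_tangent:
  "X \<in> lie_algebra G \<Longrightarrow> f \<in> polynomial_funs UNIV \<Longrightarrow> (\<And>g. g \<in> G \<Longrightarrow> f g = 0) \<Longrightarrow>
    tangent_derivative f X = 0"
  by (simp add: lie_algebra_def)

text \<open>Replaces the total operator \<open>deriv\<close> in the definition by a genuine linear
  tangent map, which every polynomial function possesses.\<close>

lemma lie_algebra_memI:
  assumes "\<And>f L. f \<in> polynomial_funs UNIV \<Longrightarrow> (\<And>g. g \<in> G \<Longrightarrow> f g = 0) \<Longrightarrow> has_tangent_map f L \<Longrightarrow> L X = 0"
  shows "X \<in> lie_algebra G"
  unfolding lie_algebra_def using assms polynomial_tangent_map has_tangent_mapD(3) by fastforce

lemma lie_algebra_memD:
  assumes "X \<in> lie_algebra G" "f \<in> polynomial_funs UNIV" "\<And>g. g \<in> G \<Longrightarrow> f g = 0" "has_tangent_map f L"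
  shows "L X = 0"
  using assms has_tangent_mapD(3)[OF assms(4)] by (auto simp: lie_algebra_def)

lemma has_tangent_map_zero: "has_tangent_map f L \<Longrightarrow> L 0 = 0"
  using has_tangent_mapD(2)[of f L 0 0] by (simp add: cmat.scale_zero_left)

lemma subspace_lie_algebra: "cmat.subspace (lie_algebra G)"
proof (rule cmat.subspaceI; rule lie_algebra_memI)
  fix X Y f L c
  assume *: "f \<in> polynomial_funs UNIV" "\<And>g. g \<in> G \<Longrightarrow> f g = 0" "has_tangent_map f L"
  note L = lie_algebra_memD[OF _ * ]
  show "L 0 = 0" using *(3) by (rule has_tangent_map_zero)
  show "L (X + Y) = 0" if "X \<in> lie_algebra G" "Y \<in> lie_algebra G"
    using L[OF that(1)] L[OF that(2)] by (simp add: has_tangent_mapD(1)[OF *(3)])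
  show "L (cscale c X) = 0" if "X \<in> lie_algebra G"
    using L[OF that] by (simp add: has_tangent_mapD(2)[OF *(3)])
qed

lemma lie_algebra_mono: "S \<subseteq> G \<Longrightarrow> lie_algebra S \<subseteq> lie_algebra G"
  by (auto simp: lie_algebra_def)

text \<open>A polynomial vanishing on \<open>G\<close> is constantly zero along the curve, and its
  derivative at time 0 is \<open>L X\<close> by the chain rule.\<close>

lemma curve_tangent_in_lie_algebra:
  assumes "\<And>t. \<gamma> (t::real) \<in> G" "\<gamma> 0 = mat 1"
    "\<And>i j. ((\<lambda>t. \<gamma> t $ i $ j) has_vector_derivative X $ i $ j) (at 0)"
  shows "X \<in> lie_algebra G"
proof (rule lie_algebra_memI)
  fix f L assume "\<And>g. g \<in> G \<Longrightarrow> f g = 0" "has_tangent_map f L"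
  then have "((\<lambda>t. 0) has_vector_derivative L X) (at (0::real))"
    using has_tangent_mapD(4)[of f L \<gamma> X] assms by simp
  then show "L X = 0" using vector_derivative_unique_at has_vector_derivative_const by blast
qed

text \<open>Makes the definite description in \<open>differential\<close> computable. Every regular
  extension of an entry of \<open>\<pi>\<close> agrees with \<open>\<pi>\<close> along the curve, so
  its tangent derivative is the velocity of the image curve; that an extension exists is part of
  \<open>algebraic_hom\<close>, after enlarging the coefficients from \<open>K\<close> to all
  complex numbers.\<close>

lemma differential_curve:
  assumes hom: "algebraic_hom K G H \<pi>" and "\<And>t. \<gamma> (t::real) \<in> G" "\<gamma> 0 = mat 1"
    "\<And>i j. ((\<lambda>t. \<gamma> t $ i $ j) has_vector_derivative X $ i $ j) (at 0)"
    "\<And>i j. ((\<lambda>t. \<pi> (\<gamma> t) $ i $ j) has_vector_derivative Y $ i $ j) (at 0)"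
  shows "differential G \<pi> X = Y"
proof -
  have eq: "tangent_derivative f X = Y $ i $ j"
    if f: "f \<in> regular_funs UNIV" "\<forall>g\<in>G. f g = \<pi> g $ i $ j" for f i j
  proof -
    obtain L where L: "has_tangent_map f L" using regular_tangent_map f by blast
    have "((\<lambda>t. \<pi> (\<gamma> t) $ i $ j) has_vector_derivative L X) (at 0)"
      using has_tangent_mapD(4)[OF L, of \<gamma> X] assms(2-4) f(2) by simp
    then show ?thesis
      using vector_derivative_unique_at assms(5) has_tangent_mapD(3)[OF L] by metis
  qed
  have "\<exists>f\<in>regular_funs UNIV. \<forall>g\<in>G. f g = \<pi> g $ i $ j" for i j
  proof -
    obtain f where "f \<in> regular_funs K" "\<forall>g\<in>G. \<pi> g $ i $ j = f g"
      using hom unfolding algebraic_hom_def by blast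
    then show ?thesis unfolding regular_funs_def using poly_algebra_mono by (metis order_refl top_greatest)
  qed
  then have "(THE d. \<forall>f \<in> regular_funs UNIV. (\<forall>g\<in>G. f g = \<pi> g $ i $ j) \<longrightarrow> tangent_derivative f X = d) = Y $ i $ j"
    for i j
    using eq by (intro the_equality) (blast, metis)
  then show ?thesis by (simp add: differential_def vec_eq_iff)
qed

lemma conjugation_polynomial:
  assumes "f \<in> polynomial_funs UNIV"
  shows "(\<lambda>x. f (g ** x ** h)) \<in> polynomial_funs UNIV"
  using assms unfolding polynomial_funs_def
proof induction
  case (coord f)
  then obtain i j where "f = (\<lambda>x. x $ i $ j)" by (auto simp: entry_funs_def)
  then show ?case
    unfolding matrix_matrix_mult_def vec_lambda_beta
    by (auto intro!: poly_algebra_sum poly_algebra.mult poly_algebra.const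
        entry_polynomial[unfolded polynomial_funs_def])
qed (auto intro: poly_algebra.intros)

text \<open>Conjugation carries the line \<open>mat 1 + cscale t X\<close> to the corresponding line
  through \<open>g ** X ** h\<close>, and precomposition with it preserves the polynomials vanishing
  on \<open>G\<close>.\<close>

lemma lie_algebra_conjugation:
  assumes X: "X \<in> lie_algebra G" and G: "\<And>x. x \<in> G \<Longrightarrow> g ** x ** h \<in> G" and inv: "g ** h = mat 1"
  shows "g ** X ** h \<in> lie_algebra G"
  unfolding lie_algebra_def
proof (intro CollectI ballI impI)
  fix f :: "complex^'a^'a \<Rightarrow> complex" assume f: "f \<in> polynomial_funs UNIV" "\<forall>g\<in>G. f g = 0"
  have "tangent_derivative (\<lambda>x. f (g ** x ** h)) X = 0"
    using f(2) G by (intro lie_algebra_tangent[OF X conjugation_polynomial[OF f(1)]]) blast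
  moreover have "g ** (mat 1 + cscale t X) ** h = mat 1 + cscale t (g ** X ** h)" for t
    by (simp add: matrix_add_ldistrib matrix_mult_add_right cscale_matrix_mult inv)
  ultimately show "tangent_derivative f (g ** X ** h) = 0"
    by (simp add: tangent_derivative_def)
qed

text \<open>The conjugated off-diagonal entry is a polynomial vanishing on \<open>S\<close>, and
  along a line through the identity it is linear in \<open>t\<close>, so its derivative is the entry
  itself.\<close>

lemma lie_algebra_diagonal:
  fixes P R :: "complex^'n^'n"
  assumes X: "X \<in> lie_algebra S" and inv: "P ** R = mat 1" and "i \<noteq> j"
    and diag: "\<And>g. g \<in> S \<Longrightarrow> (P ** g ** R) $ i $ j = 0"
  shows "(P ** X ** R) $ i $ j = 0"
proof -
  have "tangent_derivative (\<lambda>x. (P ** x ** R) $ i $ j) X = 0"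
    using diag by (rule lie_algebra_tangent[OF X conjugation_polynomial[OF entry_polynomial]])
  moreover have "(P ** (mat 1 + cscale t X) ** R) $ i $ j = t * (P ** X ** R) $ i $ j" for t
    using \<open>i \<noteq> j\<close> by (simp add: matrix_add_ldistrib matrix_mult_add_right cscale_matrix_mult inv) (simp add: mat_def)
  moreover have "deriv (\<lambda>t. t * c) 0 = c" for c :: complex
    by (rule DERIV_imp_deriv) (auto intro!: derivative_eq_intros)
  ultimately show ?thesis by (simp add: tangent_derivative_def)
qed

text \<open>The Lie algebra is cut out by linear functionals \<open>L\<close>. Each of them turns
  the family into a Laurent sum that vanishes on the circle, hence kills every coefficient.\<close>

lemma lie_algebra_weight_component:
  assumes fin: "finite I" and "\<And>z. z \<in> circle \<Longrightarrow> (\<Sum>k\<in>I. cscale (z powi k) (X k)) \<in> lie_algebra G" and "k \<in> I"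
  shows "X k \<in> lie_algebra G"
proof (rule lie_algebra_memI)
  fix f L assume f: "f \<in> polynomial_funs UNIV" "\<And>g. g \<in> G \<Longrightarrow> f g = 0" and L: "has_tangent_map f L"
  have sum: "L (\<Sum>k\<in>I. cscale (c k) (X k)) = (\<Sum>k\<in>I. c k * L (X k))" for c
    using fin by (induction I rule: finite_induct)
      (simp_all add: has_tangent_map_zero[OF L] has_tangent_mapD(1,2)[OF L])
  show "L (X k) = 0"
  proof (rule laurent_zero_on_circle[OF fin _ \<open>k \<in> I\<close>])
    fix z assume "z \<in> circle"
    from lie_algebra_memD[OF assms(2)[OF this] f L]
    show "(\<Sum>k\<in>I. L (X k) * z powi k) = 0" by (simp add: sum mult.commute)
  qed
qed

section \<open>The grading element\<close>

text \<open>The factor 1/2 matches the eigenvalue \<open>(p - q) / 2\<close> of the grading element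
  on a Hodge space; the velocity of \<phi> along \<open>cis\<close> is then \<open>2 * \<i>\<close>
  times this matrix.\<close>

definition weight_generator :: "int set \<Rightarrow> (int \<Rightarrow> complex^'n^'n) \<Rightarrow> complex^'n^'n" where
  "weight_generator I A = (\<Sum>k\<in>I. cscale (of_int k / 2) (A k))"

lemma real_matrices_cscale: "A \<in> real_matrices \<Longrightarrow> c \<in> \<real> \<Longrightarrow> cscale c A \<in> real_matrices"
  by (simp add: real_matrices_def)

context
  fixes \<phi> :: "complex \<Rightarrow> complex^'n^'n" and I A
  assumes wp: "weight_projections \<phi> I A"
begin

lemma weight_projections_finite: "finite I"
  and weight_projections_expand: "z \<in> circle \<Longrightarrow> \<phi> z = (\<Sum>k\<in>I. cscale (z powi k) (A k))"
  and weight_projections_orthogonal: "k \<in> I \<Longrightarrow> l \<in> I \<Longrightarrow> A k ** A l = (if k = l then A k else 0)"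
  and weight_projections_sum: "(\<Sum>k\<in>I. A k) = mat 1"
  using wp by (simp_all add: weight_projections_def)

lemma weight_projections_one: "\<phi> 1 = mat 1"
  by (simp add: weight_projections_expand weight_projections_sum)

lemma weight_projections_inverse: "z \<in> circle \<Longrightarrow> \<phi> z ** \<phi> (inverse z) = mat 1"
proof -
  assume z: "z \<in> circle"
  have "\<phi> z ** \<phi> (inverse z) = (\<Sum>k\<in>I. \<Sum>l\<in>I. cscale (z powi k * inverse z powi l) (A k ** A l))"
    using z by (simp add: weight_projections_expand sum_matrix_mult matrix_mult_sum_right cscale_matrix_mult mult.commute
        cmat.scale_sum_right)
      (subst sum.swap, simp add: mult_ac)
  also have "\<dots> = (\<Sum>k\<in>I. \<Sum>l\<in>I. if k = l then cscale (z powi k * inverse z powi l) (A k) else 0)"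
    by (intro sum.cong) (auto simp: weight_projections_orthogonal)
  also have "\<dots> = (\<Sum>k\<in>I. cscale (z powi k * inverse z powi k) (A k))"
    by (simp add: weight_projections_finite)
  also have "\<dots> = mat 1"
    using circle_nonzero[OF z] by (simp add: weight_projections_sum power_int_inverse)
  finally show ?thesis .
qed

lemma weight_curve_derivative:
  "((\<lambda>t. \<phi> (cis t) $ i $ j) has_vector_derivative cscale (2 * \<i>) (weight_generator I A) $ i $ j) (at 0)"
proof -
  \<comment> \<open>The entries extend to entire functions of \<open>t\<close>; they are
    differentiated over the complex numbers and then restricted to real time.\<close>
  have "((\<lambda>t. \<Sum>k\<in>I. exp (\<i> * of_int k * t) * A k $ i $ j) has_field_derivative
      (\<Sum>k\<in>I. \<i> * of_int k * A k $ i $ j)) (at 0)"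
    by (auto intro!: derivative_eq_intros)
  then have "((\<lambda>t. \<Sum>k\<in>I. exp (\<i> * of_int k * complex_of_real t) * A k $ i $ j) has_vector_derivative
      (\<Sum>k\<in>I. \<i> * of_int k * A k $ i $ j)) (at 0)"
    by (intro has_vector_derivative_real_field) simp
  moreover have "\<phi> (cis t) $ i $ j = (\<Sum>k\<in>I. exp (\<i> * of_int k * complex_of_real t) * A k $ i $ j)" for t
    by (simp add: weight_projections_expand cis_power_int) (simp add: cis_conv_exp mult_ac)
  moreover have "cscale (2 * \<i>) (weight_generator I A) $ i $ j = (\<Sum>k\<in>I. \<i> * of_int k * A k $ i $ j)"
    by (simp add: weight_generator_def sum_distrib_left mult_ac)
  ultimately show ?thesis by simp
qed

text \<open>The curve has real entries, so the imaginary part of its velocity is the derivative of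
  zero.\<close>

lemma weight_generator_real:
  assumes "\<And>z. z \<in> circle \<Longrightarrow> \<phi> z \<in> real_matrices"
  shows "cscale (2 * \<i>) (weight_generator I A) \<in> real_matrices"
  unfolding real_matrices_def
proof (intro CollectI allI)
  fix i j
  have "((\<lambda>t. Im (\<phi> (cis t) $ i $ j)) has_vector_derivative
      Im (cscale (2 * \<i>) (weight_generator I A) $ i $ j)) (at 0)"
    by (rule bounded_linear.has_vector_derivative[OF bounded_linear_Im weight_curve_derivative])
  moreover have "Im (\<phi> (cis t) $ i $ j) = 0" for t
    using assms[of "cis t"] by (simp add: real_matrices_def complex_is_Real_iff)
  ultimately have "Im (cscale (2 * \<i>) (weight_generator I A) $ i $ j) = 0"
    using vector_derivative_unique_at has_vector_derivative_const by fastforce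
  then show "cscale (2 * \<i>) (weight_generator I A) $ i $ j \<in> \<real>"
    by (simp add: complex_is_Real_iff)
qed

lemma weight_generator_projection:
  assumes "k \<in> I"
  shows "weight_generator I A ** A k = cscale (of_int k / 2) (A k)"
    "A k ** weight_generator I A = cscale (of_int k / 2) (A k)"
proof -
  have "weight_generator I A ** A k = (\<Sum>l\<in>I. if l = k then cscale (of_int k / 2) (A k) else 0)"
    unfolding weight_generator_def sum_matrix_mult cscale_matrix_mult
    using assms by (intro sum.cong) (auto simp: weight_projections_orthogonal)
  then show "weight_generator I A ** A k = cscale (of_int k / 2) (A k)"
    using assms weight_projections_finite by simp
  have "A k ** weight_generator I A = (\<Sum>l\<in>I. if l = k then cscale (of_int k / 2) (A k) else 0)"
    unfolding weight_generator_def matrix_mult_sum_right cscale_matrix_mult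
    using assms by (intro sum.cong) (auto simp: weight_projections_orthogonal)
  then show "A k ** weight_generator I A = cscale (of_int k / 2) (A k)"
    using assms weight_projections_finite by simp
qed

lemma weight_generator_projection_vec:
  "k \<in> I \<Longrightarrow> A k *v (weight_generator I A *v v) = (of_int k / 2) *s (A k *v v)"
  by (simp add: matrix_vector_mul_assoc weight_generator_projection cscale_mult_vec)

lemma weight_projections_vec: "(\<Sum>k\<in>I. A k *v v) = v"
  by (simp add: weight_projections_sum flip: sum_matrix_mult_vec)

lemma weight_projections_vec_eqI: "(\<And>k. k \<in> I \<Longrightarrow> A k *v u = A k *v v) \<Longrightarrow> u = v"
  using weight_projections_vec[of u] weight_projections_vec[of v] by (metis (no_types, lifting) sum.cong)

text \<open>Some projection does not kill the eigenvector \<open>v\<close>; applying it to the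
  eigenvalue equation gives \<open>c\<close>.\<close>

lemma weight_generator_eigenvalue:
  assumes "weight_generator I A *v v = c *s v" "v \<noteq> 0"
  obtains k where "k \<in> I" "A k \<noteq> 0" "c = of_int k / 2"
proof -
  obtain k where k: "k \<in> I" "A k *v v \<noteq> 0"
    using weight_projections_vec_eqI[of v 0] assms(2) by auto
  have "(of_int k / 2) *s (A k *v v) = c *s (A k *v v)"
    using weight_generator_projection_vec[OF k(1), of v]
    by (metis assms(1) vector_scalar_commute)
  then have "c = of_int k / 2" using k(2) by (metis vector_mul_rcancel)
  moreover have "A k \<noteq> 0" using k(2) by auto
  ultimately show ?thesis using that k(1) by blast
qed

text \<open>Diagonalizability, in the form that there is no nilpotent part at eigenvalue 0. This is
  what later excludes a nilpotent image in \<open>sl2\<close>.\<close>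

lemma weight_generator_square_kernel:
  assumes "weight_generator I A *v (weight_generator I A *v v) = 0"
  shows "weight_generator I A *v v = 0"
proof (rule weight_projections_vec_eqI)
  fix k assume k: "k \<in> I"
  have "(of_int k / 2) *s ((of_int k / 2) *s (A k *v v)) = A k *v (weight_generator I A *v (weight_generator I A *v v))"
    by (simp only: weight_generator_projection_vec[OF k])
  then have "of_int k / 2 = (0::complex) \<or> A k *v v = 0" by (simp add: assms)
  then show "A k *v (weight_generator I A *v v) = A k *v 0"
    using weight_generator_projection_vec[OF k] by auto
qed

text \<open>If the generator vanishes, then so does each \<open>A k\<close> with nonzero
  \<open>k\<close>, and \<phi> is constantly the identity.\<close>

lemma weight_generator_nonzero:
  assumes "nonconstant_on_circle \<phi>"
  shows "weight_generator I A \<noteq> 0"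
proof
  assume 0: "weight_generator I A = 0"
  have "cscale (z powi k) (A k) = A k" if "k \<in> I" for k z
  proof -
    have "cscale (of_int k / 2) (A k) = 0" using weight_generator_projection(1)[OF that] 0
      by (simp add: matrix_matrix_mult_def vec_eq_iff)
    then show ?thesis by (cases "k = 0") auto
  qed
  then have "\<phi> z = mat 1" if "z \<in> circle" for z
    using that by (simp add: weight_projections_expand weight_projections_sum)
  then show False using assms by (auto simp: nonconstant_on_circle_def)
qed

text \<open>Both sides describe \<open>A k ** \<phi> (-1)\<close>. The parity ensures that a weight
  \<open>k\<close> can be written as \<open>p - q\<close> with \<open>p + q = w\<close>.\<close>

lemma weight_parity:
  assumes "\<phi> (-1) = mat ((-1) powi w)" "k \<in> I" "A k \<noteq> 0"
  shows "even (w + k)"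
proof -
  have "A k ** \<phi> (-1) = (\<Sum>l\<in>I. if l = k then cscale ((-1) powi k) (A k) else 0)"
    using assms(2) by (simp add: weight_projections_expand matrix_mult_sum_right cscale_matrix_mult)
      (intro sum.cong, auto simp: weight_projections_orthogonal)
  also have "\<dots> = cscale ((-1) powi k) (A k)" using assms(2) weight_projections_finite by simp
  finally have "cscale ((-1) powi k) (A k) = A k ** mat ((-1) powi w)" using assms(1) by simp
  also have "mat ((-1) powi w) = cscale ((-1) powi w) (mat 1 :: complex^'n^'n)"
    by (simp add: vec_eq_iff mat_def)
  finally have "cscale ((-1) powi k) (A k) = cscale ((-1) powi w) (A k)"
    by (simp add: cscale_matrix_mult)
  then have "((-1) powi k :: complex) = (-1) powi w"
    using assms(3) by (simp add: cmat.scale_cancel_right)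
  then show ?thesis by (auto simp: power_int_minus_left split: if_splits)
qed

lemma hodge_space_projection:
  assumes "k \<in> I" "p - q = k"
  shows "A k *v v \<in> hodge_space \<phi> p q"
  unfolding hodge_space_def
proof (intro CollectI ballI)
  fix z assume z: "z \<in> circle"
  have "\<phi> z ** A k = (\<Sum>l\<in>I. if l = k then cscale (z powi k) (A k) else 0)"
    unfolding weight_projections_expand[OF z] sum_matrix_mult cscale_matrix_mult
    using assms by (intro sum.cong) (auto simp: weight_projections_orthogonal)
  then show "\<phi> z *v (A k *v v) = (z powi (p - q)) *s (A k *v v)"
    using assms weight_projections_finite by (simp add: matrix_vector_mul_assoc cscale_mult_vec)
qed

lemma weight_generator_hodge_space:
  assumes "v \<in> hodge_space \<phi> p q"
  shows "weight_generator I A *v v = (of_int (p - q) / 2) *s v"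
proof (rule weight_projections_vec_eqI)
  fix k assume k: "k \<in> I"
  have "A k *v v = 0" if "k \<noteq> p - q"
  proof -
    have "(A k *v v) $ i = 0" for i
    proof -
      \<comment> \<open>The component of weight \<open>k\<close> is scaled both by
        \<open>z powi k\<close> and by \<open>z powi (p - q)\<close>. Their difference is written as
        a two-term Laurent sum, whose coefficient at \<open>k\<close> must vanish.\<close>
      have "(\<Sum>l\<in>{k, p - q}. (if l = k then (A k *v v) $ i else - (A k *v v) $ i) * z powi l) = 0"
        if z: "z \<in> circle" for z
      proof -
        have "A k ** \<phi> z = (\<Sum>l\<in>I. if l = k then cscale (z powi k) (A k) else 0)"
          unfolding weight_projections_expand[OF z] matrix_mult_sum_right cscale_matrix_mult
          using k by (intro sum.cong) (auto simp: weight_projections_orthogonal)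
        then have "A k *v (\<phi> z *v v) = (z powi k) *s (A k *v v)"
          using k weight_projections_finite by (simp add: matrix_vector_mul_assoc cscale_mult_vec)
        moreover have "\<phi> z *v v = (z powi (p - q)) *s v"
          using assms z by (auto simp: hodge_space_def)
        ultimately have "(z powi (p - q)) *s (A k *v v) = (z powi k) *s (A k *v v)"
          by (simp add: vector_scalar_commute)
        then have "(A k *v v) $ i * z powi k = (A k *v v) $ i * z powi (p - q)"
          by (metis vector_smult_component mult.commute)
        moreover have "(\<Sum>l\<in>{k, p - q}. (if l = k then (A k *v v) $ i else - (A k *v v) $ i) * z powi l) =
            (A k *v v) $ i * z powi k - (A k *v v) $ i * z powi (p - q)"
          using \<open>k \<noteq> p - q\<close> by simp
        ultimately show ?thesis by (metis right_minus_eq)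
      qed
      from laurent_zero_on_circle[OF _ this, of k] show ?thesis by simp
    qed
    then show ?thesis by (simp add: vec_eq_iff)
  qed
  then show "A k *v (weight_generator I A *v v) = A k *v ((of_int (p - q) / 2) *s v)"
    using weight_generator_projection_vec[OF k, of v] by (cases "k = p - q") (simp_all add: vector_scalar_commute)
qed

lemma weight_generator_in_lie_algebra:
  assumes "\<phi> ` circle \<subseteq> S"
  shows "cscale (2 * \<i>) (weight_generator I A) \<in> lie_algebra S" "weight_generator I A \<in> lie_algebra S"
proof -
  show *: "cscale (2 * \<i>) (weight_generator I A) \<in> lie_algebra S"
    by (rule curve_tangent_in_lie_algebra[of "\<lambda>t. \<phi> (cis t)"])
      (use assms weight_projections_one weight_curve_derivative in auto)
  have "weight_generator I A = cscale (1 / (2 * \<i>)) (cscale (2 * \<i>) (weight_generator I A))"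
    by (simp add: cmat.scale_scale)
  then show "weight_generator I A \<in> lie_algebra S"
    using cmat.subspace_scale[OF subspace_lie_algebra *] by metis
qed

text \<open>
  The weight components of \<open>X \<in> \<gg>\<close> stay in \<open>\<gg>\<close> because they are the Laurent coefficients of
  \<open>Ad (\<phi> z) X\<close>; closure of \<open>\<gg>\<close> under brackets is not used.
\<close>

lemma weight_generator_ad_semisimple:
  assumes G: "\<And>g h. g \<in> G \<Longrightarrow> h \<in> G \<Longrightarrow> g ** h \<in> G" and \<phi>: "\<phi> ` circle \<subseteq> G"
  shows "ad_semisimple (lie_algebra G) (weight_generator I A)"
  unfolding ad_semisimple_def
proof
  fix X assume X: "X \<in> lie_algebra G"
  let ?H = "weight_generator I A"
  let ?B = "\<lambda>p. A (fst p) ** X ** A (snd p)" and ?d = "\<lambda>p. fst p - snd p"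
  define D where "D = ?d ` (I \<times> I)"
  \<comment> \<open>The blocks \<open>A k ** X ** A l\<close> with \<open>k - l = d\<close> together
    form the component of \<open>X\<close> of weight \<open>d\<close> under the adjoint action of
    \<phi>.\<close>
  define X' where "X' d = (\<Sum>p\<in>{p\<in>I\<times>I. ?d p = d}. ?B p)" for d
  have fin: "finite (I \<times> I)" "finite D" using weight_projections_finite by (auto simp: D_def)
  have grp: "(\<Sum>p\<in>I\<times>I. f (?d p) (?B p)) = (\<Sum>d\<in>D. \<Sum>p\<in>{p\<in>I\<times>I. ?d p = d}. f d (?B p))"
    for f :: "int \<Rightarrow> complex^'n^'n \<Rightarrow> complex^'n^'n"
    unfolding D_def using fin(1)
    by (subst sum.image_gen[of _ _ ?d]) (auto intro!: sum.cong)
  have conj: "\<phi> z ** X ** \<phi> (inverse z) = (\<Sum>d\<in>D. cscale (z powi d) (X' d))" if z: "z \<in> circle" for z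
  proof -
    have "\<phi> z ** X ** \<phi> (inverse z) =
        (\<Sum>k\<in>I. \<Sum>l\<in>I. cscale (z powi k) (A k) ** X ** cscale (inverse z powi l) (A l))"
      using z by (simp only: weight_projections_expand circle_simps sum_matrix_mult) (simp only: matrix_mult_sum_right)
    also have "\<dots> = (\<Sum>k\<in>I. \<Sum>l\<in>I. cscale (z powi (k - l)) (A k ** X ** A l))"
      using circle_nonzero[OF z]
      by (simp add: cscale_matrix_mult power_int_diff power_int_inverse field_simps)
    also have "\<dots> = (\<Sum>p\<in>I\<times>I. cscale (z powi (?d p)) (?B p))"
      by (simp add: sum.cartesian_product case_prod_beta)
    also have "\<dots> = (\<Sum>d\<in>D. \<Sum>p\<in>{p\<in>I\<times>I. ?d p = d}. cscale (z powi d) (?B p))"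
      by (rule grp)
    finally show ?thesis by (simp add: X'_def cmat.scale_sum_right)
  qed
  have "X' d \<in> lie_algebra G" if "d \<in> D" for d
  proof (rule lie_algebra_weight_component[OF fin(2) _ that])
    fix z assume z: "z \<in> circle"
    have "\<phi> z ** X ** \<phi> (inverse z) \<in> lie_algebra G"
    proof (rule lie_algebra_conjugation[OF X _ weight_projections_inverse[OF z]])
      have "\<phi> z \<in> G" "\<phi> (inverse z) \<in> G" using z \<phi> circle_simps(5) by blast+
      then show "\<phi> z ** x ** \<phi> (inverse z) \<in> G" if "x \<in> G" for x using G that by blast
    qed
    then show "(\<Sum>d\<in>D. cscale (z powi d) (X' d)) \<in> lie_algebra G" using conj[OF z] by simp
  qed
  moreover have "bracket ?H (X' d) = cscale (of_int d / 2) (X' d)" for d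
  proof -
    have "bracket ?H (?B p) = cscale (of_int (?d p) / 2) (?B p)" if "p \<in> I \<times> I" for p
    proof -
      have p: "fst p \<in> I" "snd p \<in> I" using that by auto
      have "?H ** ?B p = cscale (of_int (fst p) / 2) (?B p)"
        using weight_generator_projection(1)[OF p(1)]
        by (metis cscale_matrix_mult(1) matrix_mul_assoc)
      moreover have "?B p ** ?H = cscale (of_int (snd p) / 2) (?B p)"
        using weight_generator_projection(2)[OF p(2)]
        by (metis cscale_matrix_mult(2) matrix_mul_assoc)
      ultimately show ?thesis
        by (simp add: bracket_def diff_divide_distrib cmat.scale_left_diff_distrib)
    qed
    moreover have "bracket ?H (\<Sum>p\<in>P. ?B p) = (\<Sum>p\<in>P. bracket ?H (?B p))" for P
      by (simp add: bracket_def sum_matrix_mult matrix_mult_sum_right sum_subtractf)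
    ultimately show ?thesis unfolding X'_def by (auto simp: cmat.scale_sum_right intro!: sum.cong)
  qed
  ultimately have "(\<Sum>d\<in>D. X' d) \<in> cmat.span {X \<in> lie_algebra G. \<exists>c. bracket ?H X = cscale c X}"
    by (intro cmat.span_sum cmat.span_base) blast
  \<comment> \<open>At \<open>z = 1\<close> the conjugation is trivial, and its expansion becomes
    the weight decomposition of \<open>X\<close>.\<close>
  moreover have "X = (\<Sum>d\<in>D. X' d)"
    using conj[of 1] weight_projections_one by simp
  ultimately show "X \<in> cmat.span {X \<in> lie_algebra G. \<exists>c. bracket ?H X = cscale c X}"
    by simp
qed

end

text \<open>The definite description is justified here. The generator satisfies it because it is a
  multiple of the velocity of \<phi>. It is the only solution because the Hodge spaces span
  \<open>V\<close>, which fixes the image under the differential, and the differential is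
  injective.\<close>

lemma grading_element_eq:
  assumes hodge: "hodge_representation G w Q \<pi> \<phi>"
    and linear: "\<And>c X. X \<in> lie_algebra G \<Longrightarrow> differential G \<pi> (cscale c X) = cscale c (differential G \<pi> X)"
    and wp: "weight_projections \<phi> I A" and wp': "weight_projections (\<pi> \<circ> \<phi>) J B"
  shows "grading_element G w \<pi> \<phi> = weight_generator I A"
    and "differential G \<pi> (weight_generator I A) = weight_generator J B"
proof -
  let ?H = "weight_generator I A" and ?M = "weight_generator J B"
  have G: "g ** h \<in> G" if "g \<in> G" "h \<in> G" for g h
    using hodge that by (simp add: hodge_representation_def algebraic_group_def)
  have \<phi>: "\<phi> ` circle \<subseteq> G" "\<phi> ` circle \<subseteq> real_matrices"
    using hodge by (auto simp: hodge_representation_def circle_hom_def)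
  have hom: "algebraic_hom \<rat> G (aut_form Q) \<pi>" and inj: "inj_on (differential G \<pi>) (lie_algebra G)"
    and parity: "(\<pi> \<circ> \<phi>) (-1) = mat ((-1) powi w)"
    using hodge by (simp_all add: hodge_representation_def polarized_hodge_structure_def)
  have mem: "cscale (2 * \<i>) ?H \<in> lie_algebra G" "?H \<in> lie_algebra G"
    using weight_generator_in_lie_algebra[OF wp \<phi>(1)] by auto
  have "differential G \<pi> (cscale (2 * \<i>) ?H) = cscale (2 * \<i>) ?M"
  proof (rule differential_curve[OF hom, of "\<lambda>t. \<phi> (cis t)"])
    show "((\<lambda>t. \<pi> (\<phi> (cis t)) $ i $ j) has_vector_derivative cscale (2 * \<i>) ?M $ i $ j) (at 0)" for i j
      using weight_curve_derivative[OF wp', of i j] by (simp add: o_def)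
  qed (use \<phi> weight_projections_one[OF wp] weight_curve_derivative[OF wp] in auto)
  then show dH: "differential G \<pi> ?H = ?M"
    using linear[OF mem(2)] by (simp add: cmat.scale_cancel_left)
  let ?P = "\<lambda>H. H \<in> cscale \<i> ` (lie_algebra G \<inter> real_matrices) \<and>
        ad_semisimple (lie_algebra G) H \<and>
        (\<forall>p q. p + q = w \<longrightarrow> (\<forall>v \<in> hodge_space (\<pi> \<circ> \<phi>) p q.
           differential G \<pi> H *v v = (of_int (p - q) / 2) *s v))"
  show "grading_element G w \<pi> \<phi> = ?H"
    unfolding grading_element_def
  proof (rule the_equality)
    let ?N = "cscale (2 * \<i>) ?H"
    have "?N \<in> real_matrices" using weight_generator_real[OF wp] \<phi>(2) by blast
    \<comment> \<open>The real matrix required by the definition: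
      \<open>\<i> * (-1/2) * (2 * \<i>) = 1\<close>.\<close>
    then have "cscale (-1/2) ?N \<in> real_matrices" by (rule real_matrices_cscale) simp
    moreover have "cscale (-1/2) ?N \<in> lie_algebra G"
      using mem(1) cmat.subspace_scale[OF subspace_lie_algebra] by blast
    moreover have "?H = cscale \<i> (cscale (-1/2) ?N)" by (simp add: vec_eq_iff)
    ultimately have "?H \<in> cscale \<i> ` (lie_algebra G \<inter> real_matrices)" by blast
    then show "?P ?H"
      using weight_generator_ad_semisimple[OF wp G \<phi>(1)] weight_generator_hodge_space[OF wp'] dH
      by auto
  next
    fix H assume H: "?P H"
    then have hs: "\<And>p q v. p + q = w \<Longrightarrow> v \<in> hodge_space (\<pi> \<circ> \<phi>) p q \<Longrightarrow>
        differential G \<pi> H *v v = (of_int (p - q) / 2) *s v" by blast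
    from H have "H \<in> lie_algebra G" using cmat.subspace_scale[OF subspace_lie_algebra] by blast
    have "differential G \<pi> H *v v = ?M *v v" for v
    proof -
      have "differential G \<pi> H *v (B k *v v) = ?M *v (B k *v v)" if k: "k \<in> J" for k
      proof (cases "B k = 0")
        case False
        \<comment> \<open>With \<open>q = w - p\<close> this gives \<open>p - q = k\<close>, so the
          weight space is a Hodge space of the correct total weight.\<close>
        then obtain p where p: "w + k = 2 * p" using weight_parity[OF wp' parity k] by blast
        then have "B k *v v \<in> hodge_space (\<pi> \<circ> \<phi>) p (w - p)"
          using hodge_space_projection[OF wp' k, of p "w - p"] by simp
        then show ?thesis
          using hs[of p "w - p"] weight_generator_hodge_space[OF wp', of _ p "w - p"] by simp
      qed simp
      then have "(\<Sum>k\<in>J. differential G \<pi> H *v (B k *v v)) = (\<Sum>k\<in>J. ?M *v (B k *v v))" by simp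
      then show ?thesis
        by (simp add: weight_projections_vec[OF wp'] flip: vec.linear_sum[OF matrix_vector_mul_linear_gen])
    qed
    then have "differential G \<pi> H = ?M" by (simp add: matrix_eq)
    then show "H = ?H" using inj dH \<open>H \<in> lie_algebra G\<close> mem(2)
      by (intro inj_onD[OF inj]) simp_all
  qed
qed

section \<open>Symmetric powers\<close>

lemma coeff_map_poly_pderiv: "coeff (map_poly pderiv P) j = pderiv (coeff P j)"
  by (simp add: coeff_map_poly)

lemma pderiv_sum: "pderiv (\<Sum>i\<in>I. f i) = (\<Sum>i\<in>I. pderiv (f i))"
  by (induction I rule: infinite_finite_induct) (simp_all add: pderiv_add)

text \<open>The coefficientwise derivative is the partial derivative in the inner variable; this is
  its Leibniz rule.\<close>

lemma map_poly_pderiv_mult: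
  "map_poly pderiv (P * R) = map_poly pderiv P * R + P * map_poly pderiv (R :: complex poly poly)"
proof (rule poly_eqI)
  fix n
  have "coeff (map_poly pderiv (P * R)) n =
      (\<Sum>i\<le>n. pderiv (coeff P i) * coeff R (n - i) + coeff P i * pderiv (coeff R (n - i)))"
    unfolding coeff_map_poly_pderiv coeff_mult pderiv_sum pderiv_mult
    by (intro sum.cong) (simp_all add: mult.commute add.commute)
  then show "coeff (map_poly pderiv (P * R)) n = coeff (map_poly pderiv P * R + P * map_poly pderiv R) n"
    by (simp add: coeff_mult coeff_map_poly_pderiv sum.distrib)
qed

lemma sym_action_mult: "sym_action A (P * R) = sym_action A P * R + P * sym_action A R"
  by (simp add: sym_action_def map_poly_pderiv_mult pderiv_mult algebra_simps)

lemma sym_linear_add: "sym_linear (u + v) = sym_linear u + sym_linear v"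
  and sym_linear_scale: "sym_linear (c *s u) = smult [:c:] (sym_linear u)"
  by (simp_all add: sym_linear_def)

lemma sym_linear_eq_0_iff: "sym_linear u = 0 \<longleftrightarrow> u = 0"
  by (auto simp: sym_linear_def vec_eq_iff forall_2)

lemma sym_action_linear: "sym_action A (sym_linear u) = sym_linear (A *v u)"
proof -
  have "A *v u = u $ 1 *s (A *v axis 1 1) + u $ 2 *s (A *v axis 2 1)"
    by (simp add: vec_eq_iff matrix_vector_mult_def sum_2 axis_def mult.commute forall_2)
  moreover have "map_poly pderiv (sym_linear u) = [:[:u $ 1:]:]"
    by (intro poly_eqI) (simp add: coeff_map_poly_pderiv sym_linear_def coeff_pCons pderiv_pCons split: nat.split)
  moreover have "pderiv (sym_linear u) = [:[:u $ 2:]:]"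
    by (simp add: sym_linear_def pderiv_pCons)
  ultimately show ?thesis
    by (simp add: sym_action_def sym_linear_add sym_linear_scale)
qed

lemma sym_action_cscale: "sym_action (cscale c A) P = smult [:c:] (sym_action A P)"
  by (simp add: sym_action_def cscale_mult_vec sym_linear_scale smult_add_right)

lemma sym_action_power:
  assumes "sym_action A P = smult [:a:] P"
  shows "sym_action A (P ^ i) = smult [:of_nat i * a:] (P ^ i)"
proof (induction i)
  case 0
  \<comment> \<open>A derivation kills 1, since \<open>1 * 1 = 1\<close>.\<close>
  show ?case using sym_action_mult[of A 1 1] by simp
next
  case (Suc i)
  have "[:a:] + [:of_nat i * a:] = [:of_nat (Suc i) * a:]" by (simp add: algebra_simps)
  then show ?case
    by (simp only: power_Suc sym_action_mult Suc assms mult_smult_left mult_smult_right flip: smult_add_left)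
qed

text \<open>Used with opposite eigenvalues to build all weight vectors, and with eigenvalue 0 to see
  that powers of a linear form in the kernel are killed.\<close>

lemma sym_action_weight_vector:
  assumes "A *v u = a *s u" "A *v v = b *s v"
  shows "sym_action A (sym_linear u ^ i * sym_linear v ^ j) =
    smult [:of_nat i * a + of_nat j * b:] (sym_linear u ^ i * sym_linear v ^ j)"
proof -
  have "sym_action A (sym_linear u ^ i) = smult [:of_nat i * a:] (sym_linear u ^ i)"
    "sym_action A (sym_linear v ^ j) = smult [:of_nat j * b:] (sym_linear v ^ j)"
    using assms by (auto intro!: sym_action_power simp: sym_action_linear sym_linear_scale)
  moreover have "[:of_nat i * a:] + [:of_nat j * b:] = [:of_nat i * a + of_nat j * b:]" by simp
  ultimately show ?thesis
    by (simp only: sym_action_mult mult_smult_left mult_smult_right flip: smult_add_left)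
qed

lemma sym_power_mult:
  assumes "P \<in> sym_power m" "R \<in> sym_power n"
  shows "P * R \<in> sym_power (m + n)"
  unfolding sym_power_def
proof (intro CollectI allI impI)
  fix i j assume "coeff (coeff (P * R) j) i \<noteq> 0"
  then have "(\<Sum>k\<le>j. \<Sum>l\<le>i. coeff (coeff P k) l * coeff (coeff R (j - k)) (i - l)) \<noteq> 0"
    by (simp add: coeff_mult coeff_sum)
  then obtain k l where "k \<le> j" "l \<le> i" "coeff (coeff P k) l * coeff (coeff R (j - k)) (i - l) \<noteq> 0"
    by (meson sum.not_neutral_contains_not_neutral atMost_iff)
  then have "l + k = m" "(i - l) + (j - k) = n" "k \<le> j" "l \<le> i"
    using assms by (auto simp: sym_power_def)
  then show "i + j = m + n" by linarith
qed

lemma sym_linear_in_sym_power: "sym_linear u \<in> sym_power 1"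
  by (auto simp: sym_power_def sym_linear_def coeff_pCons split: nat.splits)

lemma sym_linear_power_in_sym_power: "sym_linear u ^ n \<in> sym_power n"
proof (induction n)
  case 0
  show ?case by (auto simp: sym_power_def coeff_1 split: if_splits)
next
  case (Suc n)
  then show ?case using sym_power_mult[OF sym_linear_in_sym_power] by simp
qed

lemma sym_power_expand:
  assumes "P \<in> sym_power p"
  shows "P = (\<Sum>i\<le>p. smult [:coeff (coeff P (p - i)) i:] (monom (monom 1 i) (p - i)))"
proof (intro poly_eqI)
  fix j k
  have "coeff (coeff (\<Sum>i\<le>p. smult [:coeff (coeff P (p - i)) i:] (monom (monom 1 i) (p - i))) j) k
      = (\<Sum>i\<le>p. if i = k \<and> p - i = j then coeff (coeff P j) k else 0)"
    by (auto simp: coeff_sum intro!: sum.cong)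
  also have "\<dots> = (\<Sum>i\<le>p. if i = k then (if p - k = j then coeff (coeff P j) k else 0) else 0)"
    by (intro sum.cong) auto
  also have "\<dots> = coeff (coeff P j) k"
  proof -
    have "coeff (coeff P j) k = 0" if "k + j \<noteq> p" using assms that by (auto simp: sym_power_def)
    then show ?thesis by fastforce
  qed
  finally show "coeff (coeff P j) k =
      coeff (coeff (\<Sum>i\<le>p. smult [:coeff (coeff P (p - i)) i:] (monom (monom 1 i) (p - i))) j) k"
    by simp
qed

text \<open>The preimages of the \<open>p + 1\<close> monomials of degree \<open>p\<close> span.
  Together with \<open>p + 1\<close> eigenvectors for distinct eigenvalues, this bound yields an
  eigenbasis.\<close>

lemma card_le_sym_power:
  fixes \<Psi> :: "complex^'v \<Rightarrow> complex poly poly"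
  assumes bij: "bij_betw \<Psi> UNIV (sym_power p)"
    and add: "\<And>u v. \<Psi> (u + v) = \<Psi> u + \<Psi> v" and scale: "\<And>c v. \<Psi> (c *s v) = smult [:c:] (\<Psi> v)"
  shows "CARD('v) \<le> p + 1"
proof -
  have "\<forall>i\<le>p. \<exists>v. \<Psi> v = monom (monom 1 i) (p - i)"
  proof (intro allI impI)
    fix i assume "i \<le> p"
    then have "monom (monom 1 i) (p - i) \<in> sym_power p" by (auto simp: sym_power_def split: if_splits)
    then show "\<exists>v. \<Psi> v = monom (monom 1 i) (p - i)"
      using bij by (metis bij_betw_imp_surj_on imageE)
  qed
  then obtain e where e: "\<And>i. i \<le> p \<Longrightarrow> \<Psi> (e i) = monom (monom 1 i) (p - i)" by metis
  have "\<Psi> 0 = 0" using add[of 0 0] by simp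
  then have sum: "\<Psi> (\<Sum>i\<in>J. f i) = (\<Sum>i\<in>J. \<Psi> (f i))" for f and J :: "nat set"
    by (induction J rule: infinite_finite_induct) (simp_all add: add)
  have "v \<in> vec.span (e ` {..p})" for v
  proof -
    have "\<Psi> v \<in> sym_power p" using bij bij_betw_apply by fastforce
    then have "\<Psi> v = (\<Sum>i\<le>p. smult [:coeff (coeff (\<Psi> v) (p - i)) i:] (\<Psi> (e i)))"
      using sym_power_expand e by (metis (no_types, lifting) atMost_iff sum.cong)
    also have "\<dots> = \<Psi> (\<Sum>i\<le>p. coeff (coeff (\<Psi> v) (p - i)) i *s e i)"
      by (simp add: sum scale)
    finally have "v = (\<Sum>i\<le>p. coeff (coeff (\<Psi> v) (p - i)) i *s e i)"
      using bij by (meson bij_betw_imp_inj_on injD)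
    also have "\<dots> \<in> vec.span (e ` {..p})"
      by (intro vec.span_sum vec.span_scale vec.span_base) auto
    finally show ?thesis .
  qed
  then have "vec.dim (UNIV :: (complex^'v) set) \<le> card (e ` {..p})"
    by (intro vec.dim_le_card) auto
  also have "\<dots> \<le> p + 1" using card_image_le[of "{..p}" e] by simp
  finally show ?thesis unfolding vec_dim_card .
qed

section \<open>Eigenbases for distinct eigenvalues\<close>

lemma eigenvectors_sum_zero:
  fixes M :: "complex^'v^'v"
  assumes "finite J" "\<And>j. j \<in> J \<Longrightarrow> M *v e j = c j *s e j" "\<And>j. j \<in> J \<Longrightarrow> e j \<noteq> 0" "inj_on c J"
    "(\<Sum>j\<in>J. x j *s e j) = 0"
  shows "\<forall>j\<in>J. x j = 0"
  using assms
proof (induction J arbitrary: x rule: finite_induct)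
  case (insert k J)
  let ?s = "\<lambda>x. \<Sum>j\<in>J. x j *s e j"
  have s: "x k *s e k + ?s x = 0" using insert.prems(4) insert.hyps by simp
  have "M *v (x k *s e k + ?s x) = x k *s (c k *s e k) + (\<Sum>j\<in>J. x j *s (c j *s e j))"
    using insert.prems(1)
    by (simp add: matrix_vector_right_distrib vec.linear_sum[OF matrix_vector_mul_linear_gen] vector_scalar_commute)
  then have "x k *s (c k *s e k) + (\<Sum>j\<in>J. x j *s (c j *s e j)) = 0" by (simp add: s)
  moreover have "c k *s (x k *s e k) + (\<Sum>j\<in>J. c k *s (x j *s e j)) = 0"
    using arg_cong[OF s, of "\<lambda>v. c k *s v"] by (simp add: vector_add_ldistrib vec.scale_sum_right)
  \<comment> \<open>Applying \<open>M\<close> to the relation and subtracting \<open>c k\<close>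
    times the relation eliminates \<open>e k\<close>.\<close>
  ultimately have "?s (\<lambda>j. x j * (c j - c k)) = 0"
    by (simp add: algebra_simps sum_subtractf vector_smult_assoc) (metis add_left_imp_eq)
  then have "\<forall>j\<in>J. x j * (c j - c k) = 0" using insert.prems by (intro insert.IH) auto
  moreover have "c j \<noteq> c k" if "j \<in> J" for j using insert that by (auto simp: inj_on_def)
  ultimately have "\<forall>j\<in>J. x j = 0" by auto
  then show ?case using s insert.prems(2) by auto
qed simp

context
  fixes M :: "complex^'v^'v" and e :: "nat \<Rightarrow> complex^'v" and c p
  assumes eigen: "\<And>j. j \<le> p \<Longrightarrow> M *v e j = c j *s e j" and nz: "\<And>j. j \<le> p \<Longrightarrow> e j \<noteq> 0"
    and inj: "inj_on c {..p}" and card: "CARD('v) \<le> p + 1"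
begin

lemma eigenbasis_expand: "\<exists>x. v = (\<Sum>j\<le>p. x j *s e j)"
proof -
  \<comment> \<open>Distinct eigenvalues force distinct vectors, so the image really has
    \<open>p + 1\<close> elements, as many as the dimension allows.\<close>
  have inj_e: "inj_on e {..p}"
  proof (rule inj_onI)
    fix j k assume jk: "j \<in> {..p}" "k \<in> {..p}" "e j = e k"
    then have "c j *s e j = c k *s e j" using eigen by (metis atMost_iff)
    then have "c j = c k" using nz[of j] jk by (metis atMost_iff vector_mul_rcancel)
    then show "j = k" using inj jk by (simp add: inj_on_def)
  qed
  have "vec.independent (e ` {..p})"
  proof
    assume "vec.dependent (e ` {..p})"
    then obtain u v where u: "v \<in> e ` {..p}" "u v \<noteq> 0" "(\<Sum>v\<in>e ` {..p}. u v *s v) = 0"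
      by (auto simp: vec.dependent_finite)
    then have "(\<Sum>j\<le>p. u (e j) *s e j) = 0" using inj_e by (simp add: sum.reindex)
    then have "\<forall>j\<in>{..p}. u (e j) = 0"
      using eigen nz inj by (intro eigenvectors_sum_zero[of _ M e c]) auto
    then show False using u by auto
  qed
  then have "UNIV \<subseteq> vec.span (e ` {..p})"
    using inj_e card by (intro vec.card_ge_dim_independent) (auto simp: card_image vec_dim_card simp del: vec.dim_UNIV)
  then obtain u where "v = (\<Sum>v\<in>e ` {..p}. u v *s v)"
    by (auto simp: vec.span_finite)
  then have "v = (\<Sum>j\<le>p. u (e j) *s e j)" using inj_e by (simp add: sum.reindex)
  then show ?thesis by (rule exI[of _ "\<lambda>j. u (e j)"])
qed

lemma eigenbasis_coefficients:
  assumes "M *v v = b *s v" "v = (\<Sum>j\<le>p. x j *s e j)" "j \<le> p"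
  shows "x j * (c j - b) = 0"
proof -
  have "M *v v = (\<Sum>j\<le>p. x j *s (c j *s e j))"
    unfolding assms(2) using eigen
    by (simp add: vec.linear_sum[OF matrix_vector_mul_linear_gen] vector_scalar_commute)
  moreover have "b *s v = (\<Sum>j\<le>p. b *s (x j *s e j))"
    unfolding assms(2) by (rule vec.scale_sum_right)
  ultimately have "(\<Sum>j\<le>p. (x j * (c j - b)) *s e j) = 0"
    using assms(1) by (simp add: algebra_simps sum_subtractf vector_smult_assoc)
  then have "\<forall>j\<in>{..p}. x j * (c j - b) = 0"
    using eigen nz inj by (intro eigenvectors_sum_zero[of _ M e c]) auto
  then show ?thesis using assms(3) by simp
qed

lemma eigenbasis_eigenvalue:
  assumes "M *v v = b *s v" "v \<noteq> 0"
  obtains j where "j \<le> p" "b = c j"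
proof -
  obtain x where x: "v = (\<Sum>j\<le>p. x j *s e j)" using eigenbasis_expand by blast
  have "\<exists>j\<le>p. x j \<noteq> 0"
  proof (rule ccontr)
    assume "\<not> ?thesis"
    then have "v = 0" using x by simp
    then show False using assms(2) by simp
  qed
  then show ?thesis using eigenbasis_coefficients[OF assms(1) x] that by auto
qed

lemma eigenbasis_dim:
  assumes "k \<le> p"
  shows "vec.dim {v. M *v v = c k *s v} = 1"
proof -
  have "{v. M *v v = c k *s v} = vec.span {e k}"
  proof (intro equalityI subsetI)
    fix v assume "v \<in> {v. M *v v = c k *s v}"
    then have v: "M *v v = c k *s v" by simp
    obtain x where x: "v = (\<Sum>j\<le>p. x j *s e j)" using eigenbasis_expand by blast
    have "x j *s e j = (if j = k then x k *s e k else 0)" if "j \<le> p" for j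
    proof (cases "j = k")
      case False
      then have "c j \<noteq> c k" using inj that assms by (auto simp: inj_on_def)
      then show ?thesis using eigenbasis_coefficients[OF v x that] False by simp
    qed simp
    then have "v = (\<Sum>j\<le>p. if j = k then x k *s e k else 0)" unfolding x by (intro sum.cong) auto
    then have "v = x k *s e k" using assms by simp
    then show "v \<in> vec.span {e k}" by (simp add: vec.span_scale vec.span_base)
  next
    fix v assume "v \<in> vec.span {e k}"
    then obtain a where "v = a *s e k" by (auto simp: vec.span_singleton)
    then show "v \<in> {v. M *v v = c k *s v}"
      using eigen[OF assms] by (simp add: vector_scalar_commute vector_smult_assoc mult.commute)
  qed
  then show ?thesis using nz[OF assms] by (simp add: vec.dim_span_eq_card_independent)
qed

end

section \<open>Weights of symmetric powers\<close>

lemma sl2_entries: "A \<in> sl2 \<Longrightarrow> A $ 2 $ 2 = - A $ 1 $ 1"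
  by (simp add: sl2_def trace_def sum_2 add_eq_0_iff)

text \<open>Cayley-Hamilton for trace zero: the square is \<open>- det A\<close> times the
  identity.\<close>

lemma sl2_square:
  assumes "A \<in> sl2"
  obtains a where "A ** A = cscale (a\<^sup>2) (mat 1)"
proof
  show "A ** A = cscale ((csqrt (- det A))\<^sup>2) (mat 1)"
    using sl2_entries[OF assms]
    by (simp add: vec_eq_iff forall_2 matrix_matrix_mult_def sum_2 mat_def det_2 algebra_simps)
qed

text \<open>Since \<open>(A - a) (A + a) = 0\<close>, any nonzero value of \<open>A + a\<close> is
  an eigenvector for \<open>a\<close>. If there were none, \<open>A\<close> would be the scalar
  \<open>- a\<close>, whose trace is nonzero.\<close>

lemma sl2_eigenvector:
  assumes A: "A \<in> sl2" and sq: "A ** A = cscale (a\<^sup>2) (mat 1)" and "a \<noteq> 0"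
  obtains u where "u \<noteq> 0" "A *v u = a *s u"
proof -
  have "\<exists>x. A *v x + a *s x \<noteq> 0"
  proof (rule ccontr)
    assume "\<not> ?thesis"
    then have *: "(A *v x) $ i = - a * x $ i" for x i
      by (metis (no_types, lifting) add.commute add_eq_0_iff mult_minus_left vector_add_component
          vector_smult_component zero_index)
    have "A $ 1 $ 1 = - a" "A $ 2 $ 2 = - a"
      using *[of "axis 1 1" 1] *[of "axis 2 1" 2]
      by (simp_all add: matrix_vector_mult_def sum_2 axis_def)
    then show False using sl2_entries[OF A] \<open>a \<noteq> 0\<close> by simp
  qed
  then obtain x where x: "A *v x + a *s x \<noteq> 0" by blast
  have "A *v (A *v x) = a\<^sup>2 *s x" by (simp add: matrix_vector_mul_assoc sq cscale_mult_vec)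
  then have "A *v (A *v x + a *s x) = a *s (A *v x + a *s x)"
    by (simp add: matrix_vector_right_distrib vector_scalar_commute vector_add_ldistrib
        vector_smult_assoc power2_eq_square add.commute)
  then show ?thesis using that x by blast
qed

text \<open>If \<open>A\<^sup>2\<close> is the scalar \<open>a\<^sup>2\<close>, then \<open>(ad A)\<^sup>3 = 4 a\<^sup>2 ad A\<close>.\<close>

lemma bracket_eigenvalue:
  fixes A B :: "complex^'n^'n"
  assumes sq: "A ** A = cscale (a\<^sup>2) (mat 1)" and ev: "bracket A B = cscale c B" and "B \<noteq> 0"
  shows "c = 0 \<or> c\<^sup>2 = 4 * a\<^sup>2"
proof -
  have minus: "X ** (Y - Z) = X ** Y - X ** Z" "(Y - Z) ** X = Y ** X - Z ** X" for X Y Z :: "complex^'n^'n"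
    by (simp_all add: vec_eq_iff matrix_matrix_mult_def sum_subtractf algebra_simps)
  have AAB: "A ** (A ** X) = cscale (a\<^sup>2) X" "(X ** A) ** A = cscale (a\<^sup>2) X" for X
    by (simp_all add: matrix_mul_assoc sq cscale_matrix_mult)
      (simp flip: matrix_mul_assoc add: sq cscale_matrix_mult)
  have scale: "bracket A (cscale c' X) = cscale c' (bracket A X)" for c' X
    by (simp add: bracket_def cscale_matrix_mult cmat.scale_right_diff_distrib)
  have diff: "bracket A (X - Y) = bracket A X - bracket A Y" for X Y
    by (simp add: bracket_def minus)
  have AB: "bracket A B = A ** B - B ** A" by (rule bracket_def)
  \<comment> \<open>With the square of \<open>A\<close> a scalar, iterated brackets stay in the span
    of \<open>B\<close>, \<open>A ** B\<close>, \<open>B ** A\<close> and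
    \<open>A ** B ** A\<close>.\<close>
  have words: "bracket A (A ** B) = cscale (a\<^sup>2) B - A ** B ** A"
    "bracket A (B ** A) = A ** B ** A - cscale (a\<^sup>2) B"
    "bracket A (A ** B ** A) = cscale (a\<^sup>2) (B ** A) - cscale (a\<^sup>2) (A ** B)"
    by (simp_all only: bracket_def AAB) (simp_all add: matrix_mul_assoc[symmetric] AAB)
  have "bracket A (bracket A (A ** B - B ** A)) = cscale (4 * a\<^sup>2) (A ** B - B ** A)"
    by (simp only: diff words scale AB) (simp add: vec_eq_iff algebra_simps)
  then have "bracket A (bracket A (bracket A B)) = cscale (4 * a\<^sup>2) (bracket A B)"
    by (simp only: AB)
  moreover have "bracket A (bracket A (bracket A B)) = cscale (c * c * c) B"
    by (simp add: ev scale mult.assoc)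
  ultimately have "cscale (c * c * c) B = cscale (4 * a\<^sup>2 * c) B" by (metis ev cmat.scale_scale)
  then have "c * c * c = 4 * a\<^sup>2 * c" using \<open>B \<noteq> 0\<close> cmat.scale_cancel_right by blast
  then show ?thesis by (auto simp: power2_eq_square)
qed

text \<open>Commuting means that the 2 by 2 minors of the two triples of entries vanish, so the
  triples are proportional; the factor is read off at a nonzero entry of \<open>A\<close>.\<close>

lemma sl2_centralizer:
  assumes A: "A \<in> sl2" "A \<noteq> 0" and B: "B \<in> sl2" and comm: "bracket B A = 0"
  obtains c where "B = cscale c A"
proof -
  let ?x = "A $ 1 $ 1" and ?y = "A $ 1 $ 2" and ?z = "A $ 2 $ 1"
  let ?x' = "B $ 1 $ 1" and ?y' = "B $ 1 $ 2" and ?z' = "B $ 2 $ 1"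
  have e: "A $ 2 $ 2 = - ?x" "B $ 2 $ 2 = - ?x'" using sl2_entries A(1) B by auto
  have c: "bracket B A $ i $ j = 0" for i j using comm by simp
  have 1: "?y' * ?z = ?y * ?z'" and 2: "?x' * ?y = ?x * ?y'" and 3: "?x' * ?z = ?x * ?z'"
    using c[of 1 1] c[of 1 2] c[of 2 1] e
    by (simp_all add: bracket_def matrix_matrix_mult_def sum_2 algebra_simps)
  consider "?x \<noteq> 0" | "?y \<noteq> 0" | "?z \<noteq> 0" using A e by (auto simp: vec_eq_iff forall_2)
  then show ?thesis
  proof cases
    case 1 then show ?thesis using that[of "?x' / ?x"] e \<open>?x' * ?y = _\<close> \<open>?x' * ?z = _\<close>
      by (simp add: vec_eq_iff forall_2 field_simps)
  next
    case 2 then show ?thesis using that[of "?y' / ?y"] e \<open>?y' * ?z = _\<close> \<open>?x' * ?y = _\<close>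
      by (simp add: vec_eq_iff forall_2 field_simps)
  next
    case 3 then show ?thesis using that[of "?z' / ?z"] e \<open>?y' * ?z = _\<close> \<open>?x' * ?z = _\<close>
      by (simp add: vec_eq_iff forall_2 field_simps)
  qed
qed

text \<open>Eigenvectors \<open>u\<close> and \<open>u'\<close> of \<open>A\<close> for
  \<open>a\<close> and \<open>- a\<close> give products of \<open>p - j\<close> factors
  \<open>u\<close> and \<open>j\<close> factors \<open>u'\<close>, of weight
  \<open>a * (p - 2 * j)\<close>. The hypothesis \<open>ker\<close> is what makes \<open>a\<close>
  nonzero.\<close>

lemma sym_power_weight_basis:
  fixes \<Psi> :: "complex^'v \<Rightarrow> complex poly poly" and M :: "complex^'v^'v"
  assumes bij: "bij_betw \<Psi> UNIV (sym_power p)"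
    and add: "\<And>u v. \<Psi> (u + v) = \<Psi> u + \<Psi> v" and scale: "\<And>c v. \<Psi> (c *s v) = smult [:c:] (\<Psi> v)"
    and act: "\<And>v. \<Psi> (M *v v) = sym_action A (\<Psi> v)"
    and A: "A \<in> sl2" "A \<noteq> 0" and "p \<ge> 1" and ker: "\<And>v. M *v (M *v v) = 0 \<Longrightarrow> M *v v = 0"
  obtains a e where "a \<noteq> 0" "A ** A = cscale (a\<^sup>2) (mat 1)"
    "\<And>j. j \<le> p \<Longrightarrow> M *v e j = (a * (of_nat p - 2 * of_nat j)) *s e j" "\<And>j. j \<le> p \<Longrightarrow> e j \<noteq> 0"
proof -
  have \<Psi>0: "\<Psi> 0 = 0" using add[of 0 0] by simp
  have inj: "\<Psi> u = \<Psi> v \<Longrightarrow> u = v" for u v using bij by (meson bij_betw_imp_inj_on injD)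
  have surj: "\<exists>v. \<Psi> v = P" if "P \<in> sym_power p" for P
    using bij that by (metis bij_betw_imp_surj_on imageE)
  obtain a where a: "A ** A = cscale (a\<^sup>2) (mat 1)" using sl2_square A by blast
  have "a \<noteq> 0"
  proof
    assume "a = 0"
    then have A2: "A *v (A *v x) = 0" for x
      using a by (simp add: matrix_vector_mul_assoc cscale_mult_vec)
    obtain x where x: "A *v x \<noteq> 0" using A(2) by (metis matrix_eq matrix_vector_mult_0)
    \<comment> \<open>For nilpotent \<open>A\<close> the derivation sends
      \<open>?L ^ (p - 1) * ?L'\<close> to \<open>?L ^ p\<close>, which is nonzero but is itself
      killed. This contradicts \<open>ker\<close>.\<close>
    let ?L = "sym_linear (A *v x)" and ?L' = "sym_linear x"
    have L: "sym_action A (?L ^ n) = 0" for n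
      using sym_action_weight_vector[of A "A *v x" 0 "A *v x" 0 n 0] A2 by simp
    have "?L ^ (p - 1) * ?L' \<in> sym_power p"
      using sym_power_mult[OF sym_linear_power_in_sym_power sym_linear_in_sym_power, of "A *v x" "p - 1" x]
        \<open>p \<ge> 1\<close> by simp
    then obtain v where v: "\<Psi> v = ?L ^ (p - 1) * ?L'" using surj by blast
    have "\<Psi> (M *v v) = ?L ^ p"
      using \<open>p \<ge> 1\<close> by (cases p) (simp_all add: act v sym_action_mult L sym_action_linear mult.commute)
    moreover from this have "\<Psi> (M *v (M *v v)) = \<Psi> 0" by (simp add: act[of "M *v v"] L \<Psi>0)
    then have "M *v v = 0" using ker inj by blast
    ultimately show False using x \<Psi>0 by (simp add: sym_linear_eq_0_iff)
  qed
  obtain u where u: "u \<noteq> 0" "A *v u = a *s u" using sl2_eigenvector[OF A(1) a \<open>a \<noteq> 0\<close>] by blast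
  obtain u' where u': "u' \<noteq> 0" "A *v u' = (- a) *s u'"
    using sl2_eigenvector[OF A(1), of "- a"] a \<open>a \<noteq> 0\<close> by auto
  define P where "P j = sym_linear u ^ (p - j) * sym_linear u' ^ j" for j
  have "\<forall>j. \<exists>v. j \<le> p \<longrightarrow> \<Psi> v = P j"
  proof
    fix j show "\<exists>v. j \<le> p \<longrightarrow> \<Psi> v = P j"
      using surj[of "P j"] sym_power_mult[OF sym_linear_power_in_sym_power sym_linear_power_in_sym_power, of u "p - j" u' j]
      by (cases "j \<le> p") (auto simp: P_def)
  qed
  then obtain e where e: "\<And>j. j \<le> p \<Longrightarrow> \<Psi> (e j) = P j" by metis
  show ?thesis
  proof (rule that[OF \<open>a \<noteq> 0\<close> a])
    fix j assume j: "j \<le> p"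
    have "sym_action A (P j) = smult [:a * (of_nat p - 2 * of_nat j):] (P j)"
      using sym_action_weight_vector[OF u(2) u'(2), of "p - j" j] j
      by (simp add: P_def of_nat_diff algebra_simps)
    then show "M *v e j = (a * (of_nat p - 2 * of_nat j)) *s e j"
      by (intro inj) (simp only: act scale e[OF j])
    show "e j \<noteq> 0"
      using e[OF j] u(1) u'(1) \<Psi>0 by (auto simp: P_def sym_linear_eq_0_iff)
  qed
qed

text \<open>The spectrum is a simple arithmetic progression, symmetric about 0, with step
  \<open>2 * \<bar>r\<bar>\<close>, a positive integer. Principality requires the value one below
  the maximum to occur, which forces the step to be 1.\<close>

lemma weight_string_unit_step:
  fixes M :: "complex^'v^'v" and r :: real
  assumes eigen: "\<And>j. j \<le> p \<Longrightarrow> M *v e j = of_real (r * (real p - 2 * real j)) *s e j"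
    and nz: "\<And>j. j \<le> p \<Longrightarrow> e j \<noteq> 0" and card: "CARD('v) \<le> p + 1"
    and "r \<noteq> 0" "2 * r \<in> \<int>" "p \<ge> 1"
  defines "E \<equiv> \<lambda>l::real. {v. M *v v = of_real l *s v}"
  shows "(let m = Max {l. E l \<noteq> {0}} in \<forall>k::nat. - m \<le> m - real k \<longrightarrow> vec.dim (E (m - real k)) = 1)
    \<longleftrightarrow> 2 * \<bar>r\<bar> = 1"
proof -
  define c where "c j = r * (real p - 2 * real j)" for j
  have inj: "inj_on (\<lambda>j. complex_of_real (c j)) {..p}"
    using \<open>r \<noteq> 0\<close> by (auto simp: inj_on_def c_def)
  note basis = eigen[folded c_def] nz inj card
  have spec: "E l \<noteq> {0} \<longleftrightarrow> l \<in> c ` {..p}" for l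
  proof
    assume "E l \<noteq> {0}"
    moreover have "0 \<in> E l" by (simp add: E_def)
    ultimately obtain v where "M *v v = of_real l *s v" "v \<noteq> 0" by (auto simp: E_def)
    from eigenbasis_eigenvalue[of p M e "\<lambda>j. of_real (c j)", OF basis this]
    obtain j where "j \<le> p" "complex_of_real l = of_real (c j)" by blast
    then show "l \<in> c ` {..p}" by auto
  next
    assume "l \<in> c ` {..p}"
    then obtain j where j: "j \<le> p" "l = c j" by auto
    then have "e j \<in> E l" using eigen[folded c_def] by (simp add: E_def)
    then show "E l \<noteq> {0}" using nz[OF j(1)] by auto
  qed
  have dim1: "vec.dim (E (c j)) = 1" if "j \<le> p" for j
    using eigenbasis_dim[of p M e "\<lambda>j. of_real (c j)", OF basis that] by (simp add: E_def)
  \<comment> \<open>A negative \<open>r\<close> only reverses the progression, by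
    \<open>j \<mapsto> p - j\<close>.\<close>
  have abs_mult: "\<bar>r\<bar> * (real p - 2 * real j) \<in> c ` {..p}" if "j \<le> p" for j
  proof (cases "r > 0")
    case True
    then have "\<bar>r\<bar> * (real p - 2 * real j) = c j" by (simp add: c_def)
    then show ?thesis using that by simp
  next
    case False
    then have "\<bar>r\<bar> * (real p - 2 * real j) = c (p - j)"
      using that by (simp add: c_def of_nat_diff algebra_simps)
    then show ?thesis using that by simp
  qed
  have c_abs: "\<exists>j\<le>p. l = \<bar>r\<bar> * (real p - 2 * real j)" if l: "l \<in> c ` {..p}" for l
  proof -
    obtain j where j: "j \<le> p" "l = c j" using l by auto
    show ?thesis
    proof (cases "r > 0")
      case True then show ?thesis using j by (auto simp: c_def)
    next
      case False
      then have "l = \<bar>r\<bar> * (real p - 2 * real (p - j))"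
        using j by (simp add: c_def of_nat_diff algebra_simps)
      then show ?thesis by (intro exI[of _ "p - j"]) simp
    qed
  qed
  have "Max {l. E l \<noteq> {0}} = \<bar>r\<bar> * real p"
  proof -
    have "Max (c ` {..p}) = \<bar>r\<bar> * real p"
    proof (rule Max_eqI)
      fix l assume "l \<in> c ` {..p}"
      then obtain j where "l = \<bar>r\<bar> * (real p - 2 * real j)" using c_abs by blast
      then show "l \<le> \<bar>r\<bar> * real p" by (simp add: mult_left_mono)
    qed (use abs_mult[of 0] in auto)
    then show ?thesis by (simp only: spec Collect_mem_eq)
  qed
  moreover have "(\<forall>k::nat. - (\<bar>r\<bar> * real p) \<le> \<bar>r\<bar> * real p - real k \<longrightarrow> vec.dim (E (\<bar>r\<bar> * real p - real k)) = 1)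
      \<longleftrightarrow> 2 * \<bar>r\<bar> = 1" (is "?lhs \<longleftrightarrow> _")
  proof
    assume r: "2 * \<bar>r\<bar> = 1"
    show ?lhs
    proof (intro allI impI)
      fix k :: nat assume "- (\<bar>r\<bar> * real p) \<le> \<bar>r\<bar> * real p - real k"
      moreover have half: "\<bar>r\<bar> = 1 / 2" using r by simp
      ultimately have "k \<le> p" by simp
      moreover have "\<bar>r\<bar> * real p - real k = \<bar>r\<bar> * (real p - 2 * real k)"
        unfolding half by (simp add: algebra_simps)
      ultimately show "vec.dim (E (\<bar>r\<bar> * real p - real k)) = 1"
        using abs_mult[of k] dim1 by auto
    qed
  next
    assume lhs: ?lhs
    obtain n :: int where n: "2 * r = of_int n" using \<open>2 * r \<in> \<int>\<close> by (auto elim: Ints_cases)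
    then have n': "2 * \<bar>r\<bar> = of_int \<bar>n\<bar>" by (simp add: abs_mult flip: of_int_abs)
    have "\<bar>n\<bar> \<ge> 1" using n \<open>r \<noteq> 0\<close> by (cases "n = 0") auto
    \<comment> \<open>Together with \<open>p \<ge> 1\<close> this places \<open>k = 1\<close> in the
      range \<open>- m \<le> m - k\<close>.\<close>
    then have "1 \<le> 2 * \<bar>r\<bar>" using n' by linarith
    also have "\<dots> \<le> 2 * \<bar>r\<bar> * real p" using \<open>p \<ge> 1\<close> by (simp add: mult_le_cancel_left1)
    finally have "vec.dim (E (\<bar>r\<bar> * real p - 1)) = 1" using lhs[rule_format, of 1] by simp
    moreover have "vec.dim {0 :: complex^'v} = 0" by simp
    ultimately have "E (\<bar>r\<bar> * real p - 1) \<noteq> {0}" by (metis zero_neq_one)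
    then obtain j where "\<bar>r\<bar> * real p - 1 = \<bar>r\<bar> * (real p - 2 * real j)" using spec c_abs by blast
    \<comment> \<open>The maximum minus 1 lies \<open>j\<close> steps below the maximum, so an
      integer multiple of the integral step equals 1.\<close>
    then have "2 * \<bar>r\<bar> * real j = 1" by (simp add: algebra_simps)
    then have "of_int (\<bar>n\<bar> * int j) = (1 :: real)" unfolding n' by simp
    then have "\<bar>n\<bar> * int j = 1" by linarith
    then have "\<bar>n\<bar> = 1" by (simp add: zmult_eq_1_iff)
    then show "2 * \<bar>r\<bar> = 1" using n' by simp
  qed
  ultimately show ?thesis by (simp only: Let_def)
qed

section \<open>Principal Hodge representations\<close>

lemma diagonal_matrices_commute:
  fixes U V :: "complex^'n^'n"
  assumes "\<And>i j. i \<noteq> j \<Longrightarrow> U $ i $ j = 0" "\<And>i j. i \<noteq> j \<Longrightarrow> V $ i $ j = 0"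
  shows "U ** V = V ** U"
proof -
  have "(X ** Y) $ i $ j = (if i = j then X $ i $ i * Y $ i $ i else 0)"
    if X: "\<And>i j. i \<noteq> j \<Longrightarrow> X $ i $ j = 0" and Y: "\<And>i j. i \<noteq> j \<Longrightarrow> Y $ i $ j = 0"
    for X Y :: "complex^'n^'n" and i j
  proof -
    have "(X ** Y) $ i $ j = (\<Sum>k\<in>UNIV. X $ i $ k * Y $ k $ j)"
      by (simp add: matrix_matrix_mult_def)
    also have "\<dots> = (\<Sum>k\<in>UNIV. if k = i then X $ i $ i * Y $ i $ j else 0)"
      by (intro sum.cong) (auto simp: X)
    finally show ?thesis by (simp add: Y)
  qed
  with assms show ?thesis by (simp add: vec_eq_iff mult.commute)
qed

text \<open>The matrix that diagonalizes the torus also diagonalizes its Lie algebra; diagonal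
  matrices commute, and conjugating back preserves this.\<close>

lemma torus_lie_algebra_abelian:
  fixes S :: "(complex^'n^'n) set"
  assumes torus: "real_torus S" and X: "X \<in> lie_algebra S" and Y: "Y \<in> lie_algebra S"
  shows "bracket X Y = 0"
proof -
  from torus[unfolded real_torus_def, THEN conjunct2, THEN conjunct2]
  obtain P :: "complex^'n^'n" where P: "invertible P"
    and diag: "\<forall>g\<in>S. \<forall>i j. i \<noteq> j \<longrightarrow> (P ** g ** matrix_inv P) $ i $ j = 0"
    by (elim exE conjE)
  define R where "R = matrix_inv P"
  have inv: "P ** R = mat 1" "R ** P = mat 1"
    using someI_ex[of "\<lambda>R. P ** R = mat 1 \<and> R ** P = mat 1"] P
    unfolding R_def matrix_inv_def invertible_def by auto
  have D: "(P ** Z ** R) $ i $ j = 0" if "Z \<in> lie_algebra S" "i \<noteq> j" for Z i j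
    using diag that(2) by (intro lie_algebra_diagonal[OF that(1) inv(1) that(2)]) (simp add: R_def)
  have comm: "(P ** X ** R) ** (P ** Y ** R) = (P ** Y ** R) ** (P ** X ** R)"
    by (intro diagonal_matrices_commute D X Y)
  have cancel: "R ** ((P ** Z ** R) ** (P ** W ** R)) ** P = Z ** W" for Z W
  proof -
    have "R ** ((P ** Z ** R) ** (P ** W ** R)) ** P = (R ** P) ** Z ** (R ** P) ** W ** (R ** P)"
      by (simp only: matrix_mul_assoc)
    then show ?thesis by (simp add: inv)
  qed
  have "X ** Y = Y ** X" using cancel[of X Y] cancel[of Y X] by (simp add: comm)
  then show ?thesis by (simp add: bracket_def)
qed

theorem proposition6p12:
  fixes G :: "(complex^'n^'n) set"
    and Q :: "rat^'v \<Rightarrow> rat^'v \<Rightarrow> rat"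
    and \<pi> :: "complex^'n^'n \<Rightarrow> complex^'v^'v"
    and \<phi> :: "complex \<Rightarrow> complex^'n^'n"
    and \<theta> :: "complex^'n^'n \<Rightarrow> complex^2^2"
    and S \<bb> :: "(complex^'n^'n) set"
    and \<sigma>\<^sub>1 :: "complex^'n^'n \<Rightarrow> complex"
    and T\<^sub>1 :: "complex^'n^'n"
    and w :: int and p :: nat
  assumes "hodge_representation G w Q \<pi> \<phi>"
    and "lie_iso (lie_algebra G) sl2 \<theta>"
    and "p \<ge> 1"
    and "is_sym_power_rep (lie_algebra G) \<theta> (differential G \<pi>) p"
    and "compact_maximal_torus G S" and "\<phi> ` circle \<subseteq> S"
    and "borel_subalgebra (lie_algebra G) \<bb>" and "lie_algebra S \<subseteq> \<bb>"
    and "\<bb> \<subseteq> nonneg_ad_part (lie_algebra G) (grading_element G w \<pi> \<phi>)"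
    and "simple_root (lie_algebra G) (lie_algebra S) \<bb> \<sigma>\<^sub>1"
    and "T\<^sub>1 \<in> lie_algebra S" and "\<sigma>\<^sub>1 T\<^sub>1 = 1"
    and "\<sigma>\<^sub>1 (grading_element G w \<pi> \<phi>) \<in> \<real>\<^sub>\<ge>\<^sub>0"
  shows "principal_representation G w \<pi> \<phi> \<longleftrightarrow> grading_element G w \<pi> \<phi> = T\<^sub>1"
proof -
  let ?\<gg> = "lie_algebra G" and ?\<tt> = "lie_algebra S"
  have grp: "algebraic_group \<rat> G" and hom\<phi>: "circle_hom G \<phi>"
    and hodge: "polarized_hodge_structure w Q (\<pi> \<circ> \<phi>)"
    using assms(1) by (simp_all add: hodge_representation_def)
  have inv: "invertible g" if "g \<in> G" for g
    using grp that by (auto simp: algebraic_group_def)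
  have hom\<pi>: "circle_hom (aut_form Q) (\<pi> \<circ> \<phi>)" and nonconst: "nonconstant_on_circle (\<pi> \<circ> \<phi>)"
    and parity: "(\<pi> \<circ> \<phi>) (-1) = mat ((-1) powi w)"
    using hodge by (simp_all add: polarized_hodge_structure_def)
  obtain I A where wp: "weight_projections \<phi> I A"
    using circle_hom_weight_projections[OF hom\<phi> inv] by blast
  obtain J B where wp': "weight_projections (\<pi> \<circ> \<phi>) J B"
    using circle_hom_weight_projections[OF hom\<pi>] by (auto simp: aut_form_def)
  define H where "H = weight_generator I A"
  define M where "M = weight_generator J B"

  \<comment> \<open>Transport to \<open>sl2\<close> and to the symmetric power\<close>
  have bij_\<theta>: "bij_betw \<theta> ?\<gg> sl2"
    and scale_\<theta>: "\<And>c X. X \<in> ?\<gg> \<Longrightarrow> \<theta> (cscale c X) = cscale c (\<theta> X)"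
    and bracket_\<theta>: "\<And>X Y. X \<in> ?\<gg> \<Longrightarrow> Y \<in> ?\<gg> \<Longrightarrow> \<theta> (bracket X Y) = bracket (\<theta> X) (\<theta> Y)"
    using assms(2) unfolding lie_iso_def by auto
  have zero\<gg>: "0 \<in> ?\<gg>" by (rule cmat.subspace_0[OF subspace_lie_algebra])
  have \<theta>0: "\<theta> 0 = 0" using scale_\<theta>[OF zero\<gg>, of 0] by simp
  have inj_\<theta>: "X = Y" if "\<theta> X = \<theta> Y" "X \<in> ?\<gg>" "Y \<in> ?\<gg>" for X Y
    using bij_\<theta> that by (auto simp: bij_betw_def dest: inj_onD)
  have mem_\<theta>: "\<theta> X \<in> sl2" if "X \<in> ?\<gg>" for X using bij_\<theta> that by (rule bij_betw_apply)
  have scale\<gg>: "cscale c X \<in> ?\<gg>" if "X \<in> ?\<gg>" for c X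
    using that by (rule cmat.subspace_scale[OF subspace_lie_algebra])

  obtain \<Psi> :: "complex^'v \<Rightarrow> complex poly poly" where bij: "bij_betw \<Psi> UNIV (sym_power p)"
    and add: "\<And>u v. \<Psi> (u + v) = \<Psi> u + \<Psi> v" and scale: "\<And>c v. \<Psi> (c *s v) = smult [:c:] (\<Psi> v)"
    and act: "\<And>X v. X \<in> ?\<gg> \<Longrightarrow> \<Psi> (differential G \<pi> X *v v) = sym_action (\<theta> X) (\<Psi> v)"
    using assms(4) unfolding is_sym_power_rep_def by metis
  have inj_\<Psi>: "u = v" if "\<Psi> u = \<Psi> v" for u v
    using bij that by (meson bij_betw_imp_inj_on injD)
  have \<Psi>0: "\<Psi> 0 = 0" using add[of 0 0] by simp
  \<comment> \<open>Homogeneity of the differential is read off from the symmetric power model,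
    where the action is visibly homogeneous in the matrix.\<close>
  have linear: "differential G \<pi> (cscale c X) = cscale c (differential G \<pi> X)" if X: "X \<in> ?\<gg>" for c X
  proof -
    have "differential G \<pi> (cscale c X) *v v = cscale c (differential G \<pi> X) *v v" for v
      by (rule inj_\<Psi>) (simp add: act[OF scale\<gg>[OF X]] scale_\<theta>[OF X] sym_action_cscale cscale_mult_vec scale act[OF X])
    then show ?thesis by (simp add: matrix_eq)
  qed
  have grading: "grading_element G w \<pi> \<phi> = H" and dH: "differential G \<pi> H = M"
    using grading_element_eq[OF assms(1) linear wp wp'] by (simp_all add: H_def M_def)
  have H\<tt>: "H \<in> ?\<tt>" unfolding H_def by (rule weight_generator_in_lie_algebra[OF wp assms(6)])
  have \<tt>\<gg>: "?\<tt> \<subseteq> ?\<gg>" using assms(5) by (intro lie_algebra_mono) (simp add: compact_maximal_torus_def)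
  have H\<gg>: "H \<in> ?\<gg>" using H\<tt> \<tt>\<gg> by blast
  \<comment> \<open>If the image of \<open>H\<close> were zero, \<open>H\<close> would act by zero
    on \<open>V\<close>, against the nonconstancy of the Hodge structure.\<close>
  have \<theta>H: "\<theta> H \<noteq> 0"
  proof
    assume "\<theta> H = 0"
    then have "\<theta> H = cscale 0 (\<theta> H)" by simp
    then have "\<Psi> (M *v v) = \<Psi> 0" for v
      using act[OF H\<gg>, of v] sym_action_cscale[of 0 "\<theta> H"] dH \<Psi>0 by simp
    then have "M *v v = 0 *v v" for v using inj_\<Psi> by simp
    then have "M = 0" by (simp add: matrix_eq)
    then show False using weight_generator_nonzero[OF wp' nonconst] by (simp add: M_def)
  qed

  \<comment> \<open>The spectrum of the grading element on \<open>V\<close>\<close>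
  obtain a e where a: "a \<noteq> 0" "\<theta> H ** \<theta> H = cscale (a\<^sup>2) (mat 1)"
    and e: "\<And>j. j \<le> p \<Longrightarrow> M *v e j = (a * (of_nat p - 2 * of_nat j)) *s e j"
    and e0: "\<And>j. j \<le> p \<Longrightarrow> e j \<noteq> 0"
  proof (rule sym_power_weight_basis[OF bij add scale _ mem_\<theta>[OF H\<gg>] \<theta>H assms(3)])
    show "\<Psi> (M *v v) = sym_action (\<theta> H) (\<Psi> v)" for v using act[OF H\<gg>] dH by simp
    show "M *v (M *v v) = 0 \<Longrightarrow> M *v v = 0" for v
      unfolding M_def by (rule weight_generator_square_kernel[OF wp'])
  qed blast

  \<comment> \<open>The two top weights \<open>a * p\<close> and \<open>a * (p - 2)\<close>,
    available since \<open>p \<ge> 1\<close>, are halves of integers \<open>k\<close> and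
    \<open>l\<close> of equal parity. Hence \<open>2 * a = (k - l) / 2\<close> is an
    integer.\<close>
  obtain r :: real where r: "a = of_real r" "2 * r \<in> \<int>"
  proof -
    have weight: "\<exists>k. even (w + k) \<and> c = of_int k / 2" if "M *v v = c *s v" "v \<noteq> 0" for c v
      using weight_generator_eigenvalue[OF wp' that[unfolded M_def]] weight_parity[OF wp' parity] by metis
    obtain k where k: "even (w + k)" "a * of_nat p = of_int k / 2"
      using weight[OF e[of 0] e0[of 0]] by auto
    obtain l where l: "even (w + l)" "a * (of_nat p - 2) = of_int l / 2"
      using weight[OF e[of 1] e0[of 1]] assms(3) by auto
    have "even (k - l)" using k(1) l(1) by presburger
    then obtain n where n: "k - l = 2 * n" by (elim evenE)
    have "2 * a = of_int (k - l) / 2" using k(2) l(2) by (simp add: algebra_simps diff_divide_distrib)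
    then have "2 * a = of_int n" unfolding n by simp
    then have "a = of_real (of_int n / 2)" by (simp add: field_simps)
    then show ?thesis by (rule that) simp
  qed
  have "r \<noteq> 0" using a(1) r(1) by auto
  have e_r: "M *v e j = of_real (r * (real p - 2 * real j)) *s e j" if "j \<le> p" for j
    using e[OF that] r(1) by simp
  have principal: "principal_representation G w \<pi> \<phi> \<longleftrightarrow> 2 * \<bar>r\<bar> = 1"
    using weight_string_unit_step[OF e_r e0 card_le_sym_power[OF bij add scale] \<open>r \<noteq> 0\<close> r(2) assms(3)]
    by (simp add: principal_representation_def grading_eigenspace_def grading dH)

  \<comment> \<open>The simple root and \<open>T\<^sub>1\<close>\<close>
  obtain X where X: "X \<in> ?\<gg>" "X \<noteq> 0" and X_root: "\<And>K. K \<in> ?\<tt> \<Longrightarrow> bracket K X = cscale (\<sigma>\<^sub>1 K) X"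
    and form: "linear_form_on ?\<tt> \<sigma>\<^sub>1"
    using assms(10) by (auto simp: simple_root_def positive_root_def root_def root_space_def)
  have "\<theta> X \<noteq> 0" using inj_\<theta>[of X 0] X \<theta>0 zero\<gg> by auto
  \<comment> \<open>A root vector is an eigenvector of \<open>ad H\<close>, and \<theta> carries
    this into \<open>sl2\<close>, where the eigenvalues of the adjoint action are known.\<close>
  moreover have "bracket (\<theta> H) (\<theta> X) = cscale (\<sigma>\<^sub>1 H) (\<theta> X)"
    using bracket_\<theta>[OF H\<gg> X(1)] X_root[OF H\<tt>] scale_\<theta>[OF X(1)] by simp
  ultimately have \<sigma>H: "\<sigma>\<^sub>1 H = 0 \<or> (\<sigma>\<^sub>1 H)\<^sup>2 = 4 * a\<^sup>2" using bracket_eigenvalue[OF a(2)] by blast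

  \<comment> \<open>Both elements lie in the abelian algebra of the torus, and the centralizer of
    \<open>\<theta> H\<close> in \<open>sl2\<close> is the line through it.\<close>
  have "bracket T\<^sub>1 H = 0"
    using torus_lie_algebra_abelian[OF _ assms(11) H\<tt>] assms(5) by (simp add: compact_maximal_torus_def)
  then have "bracket (\<theta> T\<^sub>1) (\<theta> H) = 0" using bracket_\<theta>[of T\<^sub>1 H] assms(11) \<tt>\<gg> H\<gg> \<theta>0 by auto
  then obtain c where "\<theta> T\<^sub>1 = cscale c (\<theta> H)"
    using sl2_centralizer[OF mem_\<theta>[OF H\<gg>] \<theta>H mem_\<theta>] assms(11) \<tt>\<gg> by blast
  then have T: "T\<^sub>1 = cscale c H"
    using inj_\<theta>[of T\<^sub>1 "cscale c H"] scale_\<theta>[OF H\<gg>] scale\<gg>[OF H\<gg>] assms(11) \<tt>\<gg> by auto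
  \<comment> \<open>This also excludes the eigenvalue 0, so only
    \<open>(\<sigma>\<^sub>1 H)\<^sup>2 = 4 * a\<^sup>2\<close> remains; the normalization then
    selects the nonnegative square root.\<close>
  have c: "c * \<sigma>\<^sub>1 H = 1" using form H\<tt> T assms(12) by (simp add: linear_form_on_def)
  obtain s where s: "\<sigma>\<^sub>1 H = of_real s" "s \<ge> 0"
    using assms(13) grading by (auto elim: nonneg_Reals_cases)
  have "complex_of_real (s\<^sup>2) = of_real ((2 * \<bar>r\<bar>)\<^sup>2)"
    using \<sigma>H c s(1) r(1) by (auto simp: power_mult_distrib simp flip: of_real_power)
  then have "s\<^sup>2 = (2 * \<bar>r\<bar>)\<^sup>2" by (simp only: of_real_eq_iff)
  then have "s = 2 * \<bar>r\<bar>" using s(2) by (rule power2_eq_imp_eq) simp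
  then have "2 * \<bar>r\<bar> = 1 \<longleftrightarrow> \<sigma>\<^sub>1 H = 1" using s(1) by (metis of_real_eq_1_iff)
  also have "\<dots> \<longleftrightarrow> H = T\<^sub>1"
  proof
    assume "\<sigma>\<^sub>1 H = 1"
    then show "H = T\<^sub>1" using c T by simp
  qed (use assms(12) in simp)
  finally show ?thesis using principal grading by simp
qed

end
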